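(* Let $n\ge 1$, let $m$ be an even positive integer and let $p$ be a positive divisor of $m$. The abstract group generated by symbols $\sigma_1,\dots,\sigma_{n-1}$ and the abelian group $T(m,p,n)$ (that is, the quotient of the free product of the free group on $\{\sigma_1,\dots,\sigma_{n-1}\}$ with $T(m,p,n)$), subject to the relations (i) $\sigma_i^2=t_i^{(-1)}t_{i+1}^{(-1)}$ for $1\le i\le n-1$; (ii) the braid relations $\sigma_i\sigma_j=\sigma_j\sigma_i$ for $i-j>1$, and $\sigma_i\sigma_{i+1}\sigma_i=\sigma_{i+1}\sigma_i\sigma_{i+1}$ for $1\le i\le n-2$; (iii) $\sigma_i t\sigma_i^{-1}=s_{i,i+1}(t)$ for all $t\in T(m,p,n)$ and $1\le i\le n-1$; is isomorphic to the group $\mu(G(m,p,n))$ via the map given by $\sigma_i\mapsto\sigma_{i,i+1}^{(1)}$ and the identity map on $T(m,p,n)$.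
   Context: Let $V$ be an $n$-dimensional complex vector space with basis $x_1,\dots,x_n$, and identify $\mathrm{GL}(V)$ with $\mathrm{GL}_n(\mathbb C)$. Let $\mathbb S_n\subset\mathrm{GL}(V)$ be the group of permutation matrices (maps permuting $\{x_1,\dots,x_n\}$) and $\mathbb T_n\subset\mathrm{GL}(V)$ the group of invertible diagonal matrices; $\mathbb S_n$ normalises $\mathbb T_n$, and for $w\in\mathbb S_n$, $t\in\mathbb T_n$ we write $w(t)=wtw^{-1}$. For a positive integer $k$, $C_k\subset\mathbb C^\times$ is the group of $k$-th roots of unity. For $p\mid m$ put $$T(m,p,n)=\{t\in\mathbb T_n\mid t^m=\mathrm{id},\ \det(t)\in C_{m/p}\}.$$ For $m$ even, the mystic reflection group is $$\mu(G(m,p,n))=\{wt\mid w\in\mathbb S_n,\ t\in T(m,1,n),\ \det(wt)\in C_{m/p}\}\subset\mathrm{GL}(V).$$ For $\epsilon\in\mathbb C^\times$: $t_i^{(\epsilon)}\in\mathbb T_n$ is defined by $t_i^{(\epsilon)}(x_i)=\epsilon x_i$ and $t_i^{(\epsilon)}(x_k)=x_k$ for $k\ne i$; $s_{i,i+1}\in\mathbb S_n$ is the transposition swapping $x_i$ and $x_{i+1}$; and for $i\neq j$, $\sigma_{ij}^{(\epsilon)}$ is defined by $\sigma_{ij}^{(\epsilon)}(x_i)=\epsilon^{-1}x_j$, $\sigma_{ij}^{(\epsilon)}(x_j)=-\epsilon x_i$, $\sigma_{ij}^{(\epsilon)}(x_k)=x_k$ for $k\ne i,j$. *)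

theory Defs
  imports
    "HOL-Algebra.Coset"
    "Jordan_Normal_Form.Determinant"
begin

definition word_step :: "('a list \<times> 'a list) set \<Rightarrow> ('a list \<times> 'a list) set" where
  "word_step R = {(u @ l @ v, u @ r @ v) | u v l r. (l, r) \<in> R}"

definition word_cong :: "('a list \<times> 'a list) set \<Rightarrow> ('a list \<times> 'a list) set" where
  "word_cong R = (word_step R \<union> (word_step R)\<inverse>)\<^sup>*"

definition word_class :: "('a list \<times> 'a list) set \<Rightarrow> 'a list \<Rightarrow> 'a list set" where
  "word_class R w = word_cong R `` {w}"

text \<open>
  The free monoid on \<^term>\<open>A\<close> modulo \<^term>\<open>R\<close>. This is intended for \<^prop>\<open>R \<subseteq> lists A \<times> lists A\<close>,
  so that the class of a word over \<^term>\<open>A\<close> consists of words over \<^term>\<open>A\<close>.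
\<close>

definition word_monoid :: "'a set \<Rightarrow> ('a list \<times> 'a list) set \<Rightarrow> 'a list set monoid" where
  "word_monoid A R =
    \<lparr>carrier = word_class R ` lists A,
     monoid.mult = (\<lambda>P Q. \<Union>u\<in>P. \<Union>v\<in>Q. word_class R (u @ v)),
     monoid.one = word_class R []\<rparr>"

text \<open>The letter \<^term>\<open>(x, True)\<close> stands for \<open>x\<close>, the letter \<^term>\<open>(x, False)\<close> for its formal inverse.\<close>

definition free_group_rels :: "'a set \<Rightarrow> (('a \<times> bool) list \<times> ('a \<times> bool) list) set" where
  "free_group_rels S = {([(x, b), (x, \<not> b)], []) | x b. x \<in> S}"

definition free_group :: "'a set \<Rightarrow> ('a \<times> bool) list set monoid" where
  "free_group S = word_monoid (S \<times> UNIV) (free_group_rels S)"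

definition free_gen :: "'a set \<Rightarrow> 'a \<Rightarrow> ('a \<times> bool) list set" where
  "free_gen S x = word_class (free_group_rels S) [(x, True)]"

definition free_product_rels ::
  "('a, 'c) monoid_scheme \<Rightarrow> ('b, 'd) monoid_scheme \<Rightarrow> (('a + 'b) list \<times> ('a + 'b) list) set" where
  "free_product_rels G H =
     {([Inl a, Inl b], [Inl (a \<otimes>\<^bsub>G\<^esub> b)]) | a b. a \<in> carrier G \<and> b \<in> carrier G}
   \<union> {([Inr a, Inr b], [Inr (a \<otimes>\<^bsub>H\<^esub> b)]) | a b. a \<in> carrier H \<and> b \<in> carrier H}
   \<union> {([Inl \<one>\<^bsub>G\<^esub>], []), ([Inr \<one>\<^bsub>H\<^esub>], [])}"

definition free_product ::
  "('a, 'c) monoid_scheme \<Rightarrow> ('b, 'd) monoid_scheme \<Rightarrow> ('a + 'b) list set monoid" where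
  "free_product G H = word_monoid (carrier G <+> carrier H) (free_product_rels G H)"

definition free_product_inl ::
  "('a, 'c) monoid_scheme \<Rightarrow> ('b, 'd) monoid_scheme \<Rightarrow> 'a \<Rightarrow> ('a + 'b) list set" where
  "free_product_inl G H a = word_class (free_product_rels G H) [Inl a]"

definition free_product_inr ::
  "('a, 'c) monoid_scheme \<Rightarrow> ('b, 'd) monoid_scheme \<Rightarrow> 'b \<Rightarrow> ('a + 'b) list set" where
  "free_product_inr G H b = word_class (free_product_rels G H) [Inr b]"

definition normal_closure :: "('a, 'c) monoid_scheme \<Rightarrow> 'a set \<Rightarrow> 'a set" where
  "normal_closure G S = \<Inter>{N. N \<lhd> G \<and> S \<subseteq> N}"

text \<open>A pair \<^term>\<open>(u, v)\<close> in \<^term>\<open>R\<close> stands for the relation \<open>u = v\<close>.\<close>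

definition group_relators :: "('a, 'c) monoid_scheme \<Rightarrow> ('a \<times> 'a) set \<Rightarrow> 'a set" where
  "group_relators G R = {u \<otimes>\<^bsub>G\<^esub> inv\<^bsub>G\<^esub> v | u v. (u, v) \<in> R}"

definition quotient_by_rels :: "('a, 'c) monoid_scheme \<Rightarrow> ('a \<times> 'a) set \<Rightarrow> 'a set monoid" where
  "quotient_by_rels G R = G Mod normal_closure G (group_relators G R)"

definition quotient_class :: "('a, 'c) monoid_scheme \<Rightarrow> ('a \<times> 'a) set \<Rightarrow> 'a \<Rightarrow> 'a set" where
  "quotient_class G R g = normal_closure G (group_relators G R) #>\<^bsub>G\<^esub> g"

text \<open>
  Linear maps are given by their matrices acting on column vectors: column \<open>j\<close> holds the
  coordinates of the image of the \<open>j\<close>-th basis vector. The basis vectors are numbered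
  \<open>0, \<dots>, n - 1\<close>, and correspondingly the braid generators below are numbered \<open>0, \<dots>, n - 2\<close>.
\<close>

definition GL :: "nat \<Rightarrow> complex mat monoid" where
  "GL n = units_of (ring_mat TYPE(complex) n ())"

definition roots_of_unity :: "nat \<Rightarrow> complex set" where
  "roots_of_unity k = {z. z ^ k = 1}"

definition perm_matrix :: "nat \<Rightarrow> (nat \<Rightarrow> nat) \<Rightarrow> complex mat" where
  "perm_matrix n \<pi> = mat n n (\<lambda>(r, c). if r = \<pi> c then 1 else 0)"

definition perm_matrices :: "nat \<Rightarrow> complex mat set" where
  "perm_matrices n = {perm_matrix n \<pi> | \<pi>. \<pi> permutes {0..<n}}"

definition diag_matrices :: "nat \<Rightarrow> complex mat set" where
  "diag_matrices n = {t \<in> carrier (GL n). diagonal_mat t}"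

definition T_group :: "nat \<Rightarrow> nat \<Rightarrow> nat \<Rightarrow> complex mat set" where
  "T_group m p n =
    {t \<in> diag_matrices n. t [^]\<^bsub>GL n\<^esub> m = \<one>\<^bsub>GL n\<^esub> \<and> det t \<in> roots_of_unity (m div p)}"

definition mystic_group :: "nat \<Rightarrow> nat \<Rightarrow> nat \<Rightarrow> complex mat set" where
  "mystic_group m p n =
    {w \<otimes>\<^bsub>GL n\<^esub> t | w t. w \<in> perm_matrices n \<and> t \<in> T_group m 1 n
        \<and> det (w \<otimes>\<^bsub>GL n\<^esub> t) \<in> roots_of_unity (m div p)}"

definition t_elem :: "nat \<Rightarrow> nat \<Rightarrow> complex \<Rightarrow> complex mat" where
  "t_elem n i \<epsilon> = mat n n (\<lambda>(r, c). if r = c then (if c = i then \<epsilon> else 1) else 0)"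

definition s_elem :: "nat \<Rightarrow> nat \<Rightarrow> nat \<Rightarrow> complex mat" where
  "s_elem n i j = perm_matrix n (Transposition.transpose i j)"

definition sigma_elem :: "nat \<Rightarrow> nat \<Rightarrow> nat \<Rightarrow> complex \<Rightarrow> complex mat" where
  "sigma_elem n i j \<epsilon> = mat n n (\<lambda>(r, c).
      if c = i then (if r = j then inverse \<epsilon> else 0)
      else if c = j then (if r = i then - \<epsilon> else 0)
      else if r = c then 1 else 0)"

definition conj_action :: "nat \<Rightarrow> complex mat \<Rightarrow> complex mat \<Rightarrow> complex mat" where
  "conj_action n w t = w \<otimes>\<^bsub>GL n\<^esub> t \<otimes>\<^bsub>GL n\<^esub> inv\<^bsub>GL n\<^esub> w"

abbreviation T_monoid :: "nat \<Rightarrow> nat \<Rightarrow> nat \<Rightarrow> complex mat monoid" where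
  "T_monoid m p n \<equiv> GL n\<lparr>carrier := T_group m p n\<rparr>"

abbreviation mystic_monoid :: "nat \<Rightarrow> nat \<Rightarrow> nat \<Rightarrow> complex mat monoid" where
  "mystic_monoid m p n \<equiv> GL n\<lparr>carrier := mystic_group m p n\<rparr>"

type_synonym braid_torus_word = "((nat \<times> bool) list set + complex mat) list set"

definition free_braid_torus :: "nat \<Rightarrow> nat \<Rightarrow> nat \<Rightarrow> braid_torus_word monoid" where
  "free_braid_torus m p n = free_product (free_group {0..<n - 1}) (T_monoid m p n)"

definition free_sigma :: "nat \<Rightarrow> nat \<Rightarrow> nat \<Rightarrow> nat \<Rightarrow> braid_torus_word" where
  "free_sigma m p n i =
    free_product_inl (free_group {0..<n - 1}) (T_monoid m p n) (free_gen {0..<n - 1} i)"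

definition free_torus :: "nat \<Rightarrow> nat \<Rightarrow> nat \<Rightarrow> complex mat \<Rightarrow> braid_torus_word" where
  "free_torus m p n t = free_product_inr (free_group {0..<n - 1}) (T_monoid m p n) t"

definition mystic_rels :: "nat \<Rightarrow> nat \<Rightarrow> nat \<Rightarrow> (braid_torus_word \<times> braid_torus_word) set" where
  "mystic_rels m p n =
    (let F = free_braid_torus m p n; \<sigma> = free_sigma m p n; \<tau> = free_torus m p n in
      {(\<sigma> i \<otimes>\<^bsub>F\<^esub> \<sigma> i, \<tau> (t_elem n i (-1) \<otimes>\<^bsub>GL n\<^esub> t_elem n (i + 1) (-1))) | i. i < n - 1}
    \<union> {(\<sigma> i \<otimes>\<^bsub>F\<^esub> \<sigma> j, \<sigma> j \<otimes>\<^bsub>F\<^esub> \<sigma> i) | i j. i < n - 1 \<and> j < n - 1 \<and> i > j + 1}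
    \<union> {(\<sigma> i \<otimes>\<^bsub>F\<^esub> \<sigma> (i + 1) \<otimes>\<^bsub>F\<^esub> \<sigma> i, \<sigma> (i + 1) \<otimes>\<^bsub>F\<^esub> \<sigma> i \<otimes>\<^bsub>F\<^esub> \<sigma> (i + 1)) | i. i + 1 < n - 1}
    \<union> {(\<sigma> i \<otimes>\<^bsub>F\<^esub> \<tau> t \<otimes>\<^bsub>F\<^esub> inv\<^bsub>F\<^esub> (\<sigma> i), \<tau> (conj_action n (s_elem n i (i + 1)) t)) | i t.
          i < n - 1 \<and> t \<in> T_group m p n})"

definition presented_group :: "nat \<Rightarrow> nat \<Rightarrow> nat \<Rightarrow> braid_torus_word set monoid" where
  "presented_group m p n = quotient_by_rels (free_braid_torus m p n) (mystic_rels m p n)"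

definition presented_sigma :: "nat \<Rightarrow> nat \<Rightarrow> nat \<Rightarrow> nat \<Rightarrow> braid_torus_word set" where
  "presented_sigma m p n i =
    quotient_class (free_braid_torus m p n) (mystic_rels m p n) (free_sigma m p n i)"

definition presented_torus :: "nat \<Rightarrow> nat \<Rightarrow> nat \<Rightarrow> complex mat \<Rightarrow> braid_torus_word set" where
  "presented_torus m p n t =
    quotient_class (free_braid_torus m p n) (mystic_rels m p n) (free_torus m p n t)"

lemma equiv_word_cong: "equiv UNIV (word_cong R)"
  unfolding word_cong_def
  by (intro equivI) (auto simp: refl_on_def trans_rtrancl intro!: sym_rtrancl sym_Un_converse)

lemma word_class_eq_iff: "word_class R u = word_class R v \<longleftrightarrow> (u, v) \<in> word_cong R"
  unfolding word_class_def by (rule eq_equiv_class_iff[OF equiv_word_cong UNIV_I UNIV_I])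

lemma word_cong_context: "(u, v) \<in> word_cong R \<Longrightarrow> (a @ u @ b, a @ v @ b) \<in> word_cong R"
  unfolding word_cong_def
proof (induction rule: rtrancl_induct)
  case (step y z)
  have step_context: "(a @ x @ b, a @ x' @ b) \<in> word_step R" if "(x, x') \<in> word_step R" for x x'
  proof -
    from that obtain c d l r where "x = c @ l @ d" "x' = c @ r @ d" "(l, r) \<in> R"
      unfolding word_step_def by blast
    then have "a @ x @ b = (a @ c) @ l @ (d @ b)" "a @ x' @ b = (a @ c) @ r @ (d @ b)"
      by simp_all
    with \<open>(l, r) \<in> R\<close> show ?thesis unfolding word_step_def by blast
  qed
  have "(a @ y @ b, a @ z @ b) \<in> word_step R \<union> (word_step R)\<inverse>"
    using step.hyps(2) by (elim UnE converseE) (simp_all add: step_context)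
  with step.IH show ?case by (rule rtrancl_into_rtrancl)
qed simp

lemma word_cong_append:
  assumes "(u, u') \<in> word_cong R" "(v, v') \<in> word_cong R"
  shows "(u @ v, u' @ v') \<in> word_cong R"
proof -
  have "(u @ v, u' @ v) \<in> word_cong R" "(u' @ v, u' @ v') \<in> word_cong R"
    using word_cong_context[OF assms(1), of "[]" v] word_cong_context[OF assms(2), of u' "[]"]
    by simp_all
  then show ?thesis unfolding word_cong_def by (rule rtrancl_trans)
qed

lemma word_cong_rel: "(l, r) \<in> R \<Longrightarrow> (l, r) \<in> word_cong R"
proof -
  assume "(l, r) \<in> R"
  then have "([] @ l @ [], [] @ r @ []) \<in> word_step R" unfolding word_step_def by blast
  then show ?thesis unfolding word_cong_def by auto
qed

lemma word_monoid_mult: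
  "word_class R u \<otimes>\<^bsub>word_monoid A R\<^esub> word_class R v = word_class R (u @ v)"
proof -
  have "word_class R (u' @ v') = word_class R (u @ v)"
    if "u' \<in> word_class R u" "v' \<in> word_class R v" for u' v'
    proof -
    from that have "(u @ v, u' @ v') \<in> word_cong R"
      by (intro word_cong_append) (simp_all add: word_class_def)
    then show ?thesis by (simp only: word_class_eq_iff[symmetric])
  qed
  moreover have "u \<in> word_class R u" "v \<in> word_class R v"
    by (auto simp: word_class_def word_cong_def)
  ultimately have "(\<Union>u'\<in>word_class R u. \<Union>v'\<in>word_class R v. word_class R (u' @ v')) = word_class R (u @ v)"
    by blast
  then show ?thesis by (simp add: word_monoid_def)
qed

lemma carrier_word_monoid: "carrier (word_monoid A R) = word_class R ` lists A"
  and one_word_monoid: "\<one>\<^bsub>word_monoid A R\<^esub> = word_class R []"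
  by (simp_all add: word_monoid_def)

lemma group_word_monoid:
  assumes "\<And>a. a \<in> A \<Longrightarrow> \<exists>b\<in>A. ([b, a], []) \<in> word_cong R"
  shows "group (word_monoid A R)"
proof (rule groupI)
  fix P assume "P \<in> carrier (word_monoid A R)"
  then obtain w where w: "w \<in> lists A" "P = word_class R w" by (auto simp: carrier_word_monoid)
  from w(1) have "\<exists>w'\<in>lists A. (w' @ w, []) \<in> word_cong R"
  proof (induction w)
    case Nil
    then show ?case by (auto simp: word_cong_def)
  next
    case (Cons a w)
    then obtain w' b where w': "w' \<in> lists A" "(w' @ w, []) \<in> word_cong R"
      and b: "b \<in> A" "([b, a], []) \<in> word_cong R" using assms by blast
    from word_cong_context[OF b(2), of w' w]
    have "((w' @ [b]) @ a # w, w' @ w) \<in> word_cong R" by simp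
    with w'(2) have "((w' @ [b]) @ a # w, []) \<in> word_cong R"
      unfolding word_cong_def by (meson rtrancl_trans)
    moreover have "w' @ [b] \<in> lists A" using w' b by simp
    ultimately show ?case by blast
  qed
  then obtain w' where w': "w' \<in> lists A" "word_class R (w' @ w) = word_class R []"
    unfolding word_class_eq_iff by blast
  show "\<exists>Q\<in>carrier (word_monoid A R). Q \<otimes>\<^bsub>word_monoid A R\<^esub> P = \<one>\<^bsub>word_monoid A R\<^esub>"
  proof (rule bexI)
    show "word_class R w' \<otimes>\<^bsub>word_monoid A R\<^esub> P = \<one>\<^bsub>word_monoid A R\<^esub>"
      by (simp only: w(2) word_monoid_mult w'(2) one_word_monoid)
    show "word_class R w' \<in> carrier (word_monoid A R)"
      unfolding carrier_word_monoid using w'(1) by (rule imageI)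
  qed
next
  fix P Q assume "P \<in> carrier (word_monoid A R)" "Q \<in> carrier (word_monoid A R)"
  then obtain u v where "u \<in> lists A" "P = word_class R u" "v \<in> lists A" "Q = word_class R v"
    by (auto simp: carrier_word_monoid)
  then show "P \<otimes>\<^bsub>word_monoid A R\<^esub> Q \<in> carrier (word_monoid A R)"
    by (simp add: word_monoid_mult carrier_word_monoid)
next
  fix P Q P' assume "P \<in> carrier (word_monoid A R)" "Q \<in> carrier (word_monoid A R)"
    "P' \<in> carrier (word_monoid A R)"
  then obtain u v w where "P = word_class R u" "Q = word_class R v" "P' = word_class R w"
    by (auto simp: carrier_word_monoid)
  then show "P \<otimes>\<^bsub>word_monoid A R\<^esub> Q \<otimes>\<^bsub>word_monoid A R\<^esub> P' = P \<otimes>\<^bsub>word_monoid A R\<^esub> (Q \<otimes>\<^bsub>word_monoid A R\<^esub> P')"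
    by (simp add: word_monoid_mult)
next
  fix P assume "P \<in> carrier (word_monoid A R)"
  then obtain u where u: "P = word_class R u" by (auto simp: carrier_word_monoid)
  show "\<one>\<^bsub>word_monoid A R\<^esub> \<otimes>\<^bsub>word_monoid A R\<^esub> P = P"
    by (simp only: u one_word_monoid word_monoid_mult append_Nil)
next
  show "\<one>\<^bsub>word_monoid A R\<^esub> \<in> carrier (word_monoid A R)"
    by (simp add: one_word_monoid carrier_word_monoid)
qed

lemma group_free_group: "group (free_group S)"
  unfolding free_group_def
proof (rule group_word_monoid)
  fix a assume "a \<in> S \<times> (UNIV :: bool set)"
  then obtain x b where a: "a = (x, b)" "x \<in> S" by blast
  then have "([(x, \<not> b), (x, \<not> \<not> b)], []) \<in> free_group_rels S"
    unfolding free_group_rels_def by blast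
  then show "\<exists>c\<in>S \<times> UNIV. ([c, a], []) \<in> word_cong (free_group_rels S)"
    using a by (intro bexI[of _ "(x, \<not> b)"]) (auto intro: word_cong_rel)
qed

lemma group_free_product:
  assumes "group G" "group H"
  shows "group (free_product G H)"
  unfolding free_product_def
proof (rule group_word_monoid)
  interpret G: group G by fact
  interpret H: group H by fact
  let ?R = "free_product_rels G H"
  fix a assume "a \<in> carrier G <+> carrier H"
  then show "\<exists>c\<in>carrier G <+> carrier H. ([c, a], []) \<in> word_cong ?R"
  proof
    fix x assume x: "a = Inl x" "x \<in> carrier G"
    then have "([Inl (inv\<^bsub>G\<^esub> x), Inl x], [Inl (inv\<^bsub>G\<^esub> x \<otimes>\<^bsub>G\<^esub> x)]) \<in> ?R"
      unfolding free_product_rels_def by blast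
    then have "([Inl (inv\<^bsub>G\<^esub> x), a], [Inl \<one>\<^bsub>G\<^esub>]) \<in> word_cong ?R"
      using x by (auto intro: word_cong_rel)
    moreover have "([Inl \<one>\<^bsub>G\<^esub>], []) \<in> word_cong ?R"
      by (rule word_cong_rel) (simp add: free_product_rels_def)
    ultimately have "([Inl (inv\<^bsub>G\<^esub> x), a], []) \<in> word_cong ?R"
      unfolding word_cong_def by (rule rtrancl_trans)
    then show ?thesis using x by blast
  next
    fix x assume x: "a = Inr x" "x \<in> carrier H"
    then have "([Inr (inv\<^bsub>H\<^esub> x), Inr x], [Inr (inv\<^bsub>H\<^esub> x \<otimes>\<^bsub>H\<^esub> x)]) \<in> ?R"
      unfolding free_product_rels_def by blast
    then have "([Inr (inv\<^bsub>H\<^esub> x), a], [Inr \<one>\<^bsub>H\<^esub>]) \<in> word_cong ?R"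
      using x by (auto intro: word_cong_rel)
    moreover have "([Inr \<one>\<^bsub>H\<^esub>], []) \<in> word_cong ?R"
      by (rule word_cong_rel) (simp add: free_product_rels_def)
    ultimately have "([Inr (inv\<^bsub>H\<^esub> x), a], []) \<in> word_cong ?R"
      unfolding word_cong_def by (rule rtrancl_trans)
    then show ?thesis using x by blast
  qed
qed

lemma normal_normal_closure:
  assumes "group G" "S \<subseteq> carrier G"
  shows "normal_closure G S \<lhd> G"
proof -
  interpret group G by fact
  have "carrier G \<lhd> G"
    unfolding normal_inv_iff by (simp add: subgroup_self)
  then have ne: "{N. N \<lhd> G \<and> S \<subseteq> N} \<noteq> {}" using assms(2) by blast
  have "subgroup (normal_closure G S) G"
    unfolding normal_closure_def using ne by (rule subgroups_Inter[rotated]) (blast intro: normal_imp_subgroup)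
  moreover have "x \<otimes>\<^bsub>G\<^esub> h \<otimes>\<^bsub>G\<^esub> inv\<^bsub>G\<^esub> x \<in> normal_closure G S"
    if "x \<in> carrier G" "h \<in> normal_closure G S" for x h
    unfolding normal_closure_def
  proof (rule InterI)
    fix N assume N: "N \<in> {N. N \<lhd> G \<and> S \<subseteq> N}"
    then have "h \<in> N" using that(2) unfolding normal_closure_def by blast
    then show "x \<otimes>\<^bsub>G\<^esub> h \<otimes>\<^bsub>G\<^esub> inv\<^bsub>G\<^esub> x \<in> N"
      using N that(1) normal.inv_op_closed2[of N G x h] by blast
  qed
  ultimately show ?thesis unfolding normal_inv_iff by blast
qed

lemma carrier_GL: "carrier (GL n) = Units (ring_mat TYPE(complex) n ())"
  and mult_GL: "A \<otimes>\<^bsub>GL n\<^esub> B = A * B"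
  and one_GL: "\<one>\<^bsub>GL n\<^esub> = 1\<^sub>m n"
  by (simp_all add: GL_def units_of_def ring_mat_simps)

lemma group_GL: "group (GL n)"
proof -
  interpret ring "ring_mat TYPE(complex) n ()" by (rule ring_mat)
  show ?thesis unfolding GL_def by (rule units_group)
qed

lemma GL_iff_det: "A \<in> carrier (GL n) \<longleftrightarrow> A \<in> carrier_mat n n \<and> det A \<noteq> 0"
  unfolding carrier_GL
  using det_non_zero_imp_unit[of A n] unit_imp_det_non_zero[of A n]
  by (auto simp: Units_def ring_mat_simps)

lemma diagonal_mult:
  assumes "A \<in> carrier_mat n n" "B \<in> carrier_mat n n" "diagonal_mat A" "diagonal_mat (B :: complex mat)"
  shows "diagonal_mat (A * B)" "A * B = B * A"
proof -
  have *: "(A * B) $$ (i, j) = (if i = j then A $$ (i, i) * B $$ (i, i) else 0)"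
    if "i < n" "j < n" "A \<in> carrier_mat n n" "B \<in> carrier_mat n n"
       "diagonal_mat A" "diagonal_mat B" for A B :: "complex mat" and i j
  proof -
    have "(A * B) $$ (i, j) = (\<Sum>k\<in>{0..<n}. A $$ (i, k) * B $$ (k, j))"
      using that by (auto simp: scalar_prod_def)
    also have "\<dots> = (\<Sum>k\<in>{0..<n}. if k = i then A $$ (i, k) * B $$ (k, j) else 0)"
      using that by (intro sum.cong) (auto simp: diagonal_mat_def)
    also have "\<dots> = A $$ (i, i) * B $$ (i, j)"
      using that by simp
    finally show ?thesis using that by (auto simp: diagonal_mat_def)
  qed
  show "diagonal_mat (A * B)"
    unfolding diagonal_mat_def
  proof (intro allI impI)
    fix i j assume "i < dim_row (A * B)" "j < dim_col (A * B)" "i \<noteq> j"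
    then show "(A * B) $$ (i, j) = 0" using *[of i j A B] assms by auto
  qed
  show "A * B = B * A"
  proof (rule eq_matI)
    fix i j assume "i < dim_row (B * A)" "j < dim_col (B * A)"
    then show "(A * B) $$ (i, j) = (B * A) $$ (i, j)"
      using *[of i j A B] *[of i j B A] assms by auto
  qed (use assms in auto)
qed

lemma subgroup_diag_matrices: "subgroup (diag_matrices n) (GL n)"
proof -
  interpret group "GL n" by (rule group_GL)
  show ?thesis
  proof
    show "diag_matrices n \<subseteq> carrier (GL n)" by (auto simp: diag_matrices_def)
  next
    fix A B assume "A \<in> diag_matrices n" "B \<in> diag_matrices n"
    then show "A \<otimes>\<^bsub>GL n\<^esub> B \<in> diag_matrices n"
      using m_closed[of A B] diagonal_mult(1)[of A n B]
      by (auto simp: diag_matrices_def mult_GL GL_iff_det)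
  next
    have "diagonal_mat (\<one>\<^bsub>GL n\<^esub>)" by (simp add: one_GL diagonal_mat_def)
    then show "\<one>\<^bsub>GL n\<^esub> \<in> diag_matrices n" by (simp add: diag_matrices_def)
  next
    fix A assume "A \<in> diag_matrices n"
    then have A: "A \<in> carrier (GL n)" "diagonal_mat A" by (auto simp: diag_matrices_def)
    then have Ac: "A \<in> carrier_mat n n" by (simp add: GL_iff_det)
    define B where "B = inv\<^bsub>GL n\<^esub> A"
    have B: "B \<in> carrier (GL n)" using A by (simp add: B_def)
    then have Bc: "B \<in> carrier_mat n n" by (simp add: GL_iff_det)
    have AB: "A * B = 1\<^sub>m n" using A r_inv[of A] by (simp add: B_def mult_GL one_GL)
    have ent: "A $$ (i, i) * B $$ (i, j) = (1\<^sub>m n :: complex mat) $$ (i, j)" if "i < n" "j < n" for i j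
    proof -
      have "(A * B) $$ (i, j) = (\<Sum>k\<in>{0..<n}. A $$ (i, k) * B $$ (k, j))"
        using that Ac Bc by (auto simp: scalar_prod_def)
      also have "\<dots> = (\<Sum>k\<in>{0..<n}. if k = i then A $$ (i, k) * B $$ (k, j) else 0)"
        using that Ac A by (intro sum.cong) (auto simp: diagonal_mat_def)
      also have "\<dots> = A $$ (i, i) * B $$ (i, j)" using that by simp
      finally show ?thesis by (simp add: AB)
    qed
    have "diagonal_mat B"
      unfolding diagonal_mat_def
    proof (intro allI impI)
      fix i j assume "i < dim_row B" "j < dim_col B" "i \<noteq> j"
      then have ij: "i < n" "j < n" "i \<noteq> j" using Bc by auto
      then show "B $$ (i, j) = 0" using ent[of i j] ent[of i i] by auto
    qed
    then show "inv\<^bsub>GL n\<^esub> A \<in> diag_matrices n" using B by (simp add: diag_matrices_def B_def)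
  qed
qed

lemma det_one_GL: "det (\<one>\<^bsub>GL n\<^esub>) = 1"
  by (simp add: one_GL)

lemma det_mult_GL:
  assumes "A \<in> carrier (GL n)" "B \<in> carrier (GL n)"
  shows "det (A \<otimes>\<^bsub>GL n\<^esub> B) = det A * det B"
  using assms by (auto simp: mult_GL GL_iff_det intro: det_mult)

lemma subgroup_T_group: "subgroup (T_group m p n) (GL n)"
proof -
  interpret group "GL n" by (rule group_GL)
  interpret D: subgroup "diag_matrices n" "GL n" by (rule subgroup_diag_matrices)
  show ?thesis
  proof
    show "T_group m p n \<subseteq> carrier (GL n)" using D.subset by (auto simp: T_group_def)
  next
    fix A B assume AB: "A \<in> T_group m p n" "B \<in> T_group m p n"
    then have c: "A \<in> carrier (GL n)" "B \<in> carrier (GL n)"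
      using D.subset by (auto simp: T_group_def)
    have "A \<otimes>\<^bsub>GL n\<^esub> B = B \<otimes>\<^bsub>GL n\<^esub> A"
      using AB diagonal_mult(2)[of A n B]
      by (auto simp: T_group_def diag_matrices_def GL_iff_det mult_GL)
    then have "(A \<otimes>\<^bsub>GL n\<^esub> B) [^]\<^bsub>GL n\<^esub> m = A [^]\<^bsub>GL n\<^esub> m \<otimes>\<^bsub>GL n\<^esub> B [^]\<^bsub>GL n\<^esub> m"
      using c by (rule pow_mult_distrib)
    then show "A \<otimes>\<^bsub>GL n\<^esub> B \<in> T_group m p n"
      using AB c
      by (auto simp: T_group_def roots_of_unity_def det_mult_GL power_mult_distrib)
  next
    show "\<one>\<^bsub>GL n\<^esub> \<in> T_group m p n"
      by (simp add: T_group_def roots_of_unity_def det_one_GL)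
  next
    fix A assume A: "A \<in> T_group m p n"
    then have c: "A \<in> carrier (GL n)" using D.subset by (auto simp: T_group_def)
    have "(inv\<^bsub>GL n\<^esub> A) [^]\<^bsub>GL n\<^esub> m = inv\<^bsub>GL n\<^esub> (A [^]\<^bsub>GL n\<^esub> m)"
      using c by (simp add: nat_pow_inv)
    moreover have "det A * det (inv\<^bsub>GL n\<^esub> A) = 1"
      using c det_mult_GL[of A n "inv\<^bsub>GL n\<^esub> A"] by (simp add: det_one_GL)
    then have "det A ^ (m div p) * det (inv\<^bsub>GL n\<^esub> A) ^ (m div p) = 1"
      by (metis power_mult_distrib power_one)
    ultimately show "inv\<^bsub>GL n\<^esub> A \<in> T_group m p n"
      using A by (auto simp: T_group_def roots_of_unity_def)
  qed
qed

lemma group_free_braid_torus: "group (free_braid_torus m p n)"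
  unfolding free_braid_torus_def
  by (intro group_free_product group_free_group subgroup.subgroup_is_group subgroup_T_group group_GL)

end

theory Submission
  imports Defs "HOL-Algebra.Generated_Groups"
begin

text \<open>
  The matrices \<open>\<sigma>\<^sub>i\<close> and the group \<open>T = T(m,p,n)\<close> satisfy the defining relations, so the universal
  property of the presentation yields a homomorphism \<open>\<phi>\<close> from the presented group \<open>P\<close> to the general
  linear group (\<open>presented_group_universal\<close>). It remains to find its image and its kernel.

  Both rest on a factorization. By relation (iii) the image \<open>N\<close> of \<open>T\<close> in \<open>P\<close> can be moved past the
  generators \<open>\<sigma>\<^sub>i\<close>, and by relation (i) the inverse of \<open>\<sigma>\<^sub>i\<close> lies in \<open>\<sigma>\<^sub>i N\<close>. So every element of \<open>P\<close> is
  a positive word in the \<open>\<sigma>\<^sub>i\<close> times an element of \<open>N\<close> (\<open>generated_factorization\<close>). The map \<open>\<phi>\<close> sends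
  a positive word \<open>w\<close> to a monomial matrix of determinant 1 with entries \<open>\<plusminus>1\<close>, whose underlying permutation
  is the corresponding product of adjacent transpositions (\<open>sigma_word_monomial\<close>).

  Image: a matrix lies in the mystic group iff it is monomial, its nonzero entries are \<open>m\<close>-th roots of
  unity and its determinant lies in \<open>C\<^bsub>m/p\<^esub>\<close> (\<open>mystic_group_iff\<close>). Words times torus elements are of this
  form; since \<open>m\<close> is even, the signs are \<open>m\<close>-th roots of unity. Conversely, adjacent transpositions
  generate the symmetric group, so any such matrix differs by a diagonal factor from the image of a word,
  and this factor has the same determinant and lies in \<open>T\<close>.

  Kernel: if \<open>w\<close> times \<open>t\<close> is in the kernel then the permutation of \<open>w\<close> is trivial. Modulo \<open>N\<close> the
  \<open>\<sigma>\<^sub>i\<close> satisfy the Coxeter relations of the symmetric group, and these suffice to reduce every word with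
  trivial permutation to the empty one (\<open>word_perm_id_imp_mem\<close>). So the kernel lies in \<open>N\<close>, and on \<open>N\<close> the
  map \<open>\<phi>\<close> is injective because it restricts to the identity of \<open>T\<close>.
\<close>

section \<open>Products of words\<close>

definition word_prod :: "('g, 'c) monoid_scheme \<Rightarrow> ('x \<Rightarrow> 'g) \<Rightarrow> 'x list \<Rightarrow> 'g" where
  "word_prod G a w = foldr (\<lambda>x g. a x \<otimes>\<^bsub>G\<^esub> g) w \<one>\<^bsub>G\<^esub>"

lemma word_prod_Nil [simp]: "word_prod G a [] = \<one>\<^bsub>G\<^esub>"
  and word_prod_Cons [simp]: "word_prod G a (x # w) = a x \<otimes>\<^bsub>G\<^esub> word_prod G a w"
  by (simp_all add: word_prod_def)

lemma (in monoid) word_prod_closed: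
  "(\<And>x. x \<in> set w \<Longrightarrow> a x \<in> carrier G) \<Longrightarrow> word_prod G a w \<in> carrier G"
  by (induction w) simp_all

lemma (in monoid) word_prod_append:
  assumes "\<And>x. x \<in> set (u @ v) \<Longrightarrow> a x \<in> carrier G"
  shows "word_prod G a (u @ v) = word_prod G a u \<otimes> word_prod G a v"
  using assms by (induction u) (simp_all add: word_prod_closed m_assoc)

lemma word_prod_cong:
  "(\<And>x. x \<in> set w \<Longrightarrow> a x = b x) \<Longrightarrow> word_prod G a w = word_prod G b w"
  by (induction w) simp_all

lemma (in group_hom) hom_word_prod:
  "(\<And>x. x \<in> set w \<Longrightarrow> a x \<in> carrier G) \<Longrightarrow> h (word_prod G a w) = word_prod H (\<lambda>x. h (a x)) w"
  by (induction w) (simp_all add: G.word_prod_closed)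

section \<open>Universal properties and generators of presented groups\<close>

text \<open>
  Each elementary rewriting step replaces a factor \<open>l\<close> by \<open>r\<close>, and a product over a word only depends on
  the products over its factors. Membership in \<^term>\<open>lists A\<close> is carried along because \<^term>\<open>f\<close> is only
  controlled on \<^term>\<open>A\<close>.
\<close>

lemma word_cong_word_prod:
  assumes "monoid K" and "(u, v) \<in> word_cong R" and "u \<in> lists A" and "R \<subseteq> lists A \<times> lists A"
    and f: "\<And>x. x \<in> A \<Longrightarrow> f x \<in> carrier K"
    and rel: "\<And>l r. (l, r) \<in> R \<Longrightarrow> word_prod K f l = word_prod K f r"
  shows "v \<in> lists A \<and> word_prod K f u = word_prod K f v"
proof -
  interpret K: monoid K by fact
  have one_step: "(x \<in> lists A \<longleftrightarrow> y \<in> lists A) \<and> (x \<in> lists A \<longrightarrow> word_prod K f x = word_prod K f y)"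
    if xy: "(x, y) \<in> word_step R" for x y
  proof -
    from xy obtain c d l r where xy: "x = c @ l @ d" "y = c @ r @ d" "(l, r) \<in> R"
      unfolding word_step_def by blast
    then have lr: "l \<in> lists A" "r \<in> lists A" using assms(4) by auto
    have "word_prod K f x = word_prod K f y" if "x \<in> lists A"
    proof -
      have "word_prod K f x = word_prod K f c \<otimes>\<^bsub>K\<^esub> (word_prod K f l \<otimes>\<^bsub>K\<^esub> word_prod K f d)"
        using that unfolding xy by (subst K.word_prod_append K.word_prod_append, use f in auto)+
      moreover have "word_prod K f y = word_prod K f c \<otimes>\<^bsub>K\<^esub> (word_prod K f r \<otimes>\<^bsub>K\<^esub> word_prod K f d)"
        using that lr unfolding xy by (subst K.word_prod_append K.word_prod_append, use f in auto)+
      ultimately show ?thesis using rel[OF xy(3)] by simp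
    qed
    then show ?thesis using lr xy by auto
  qed
  from assms(2) show ?thesis unfolding word_cong_def
  proof (induction rule: rtrancl_induct)
    case base
    then show ?case using assms(3) by simp
  next
    case (step y z)
    then show ?case using one_step[of y z] one_step[of z y] by auto
  qed
qed

lemma word_monoid_universal:
  assumes "monoid K" and "R \<subseteq> lists A \<times> lists A"
    and f: "\<And>x. x \<in> A \<Longrightarrow> f x \<in> carrier K"
    and rel: "\<And>l r. (l, r) \<in> R \<Longrightarrow> word_prod K f l = word_prod K f r"
  obtains h where "h \<in> hom (word_monoid A R) K"
    and "\<And>w. w \<in> lists A \<Longrightarrow> h (word_class R w) = word_prod K f w"
proof -
  interpret K: monoid K by fact
  define h where "h P = word_prod K f (SOME w. w \<in> P)" for P
  have h: "h (word_class R w) = word_prod K f w" if "w \<in> lists A" for w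
  proof -
    have "w \<in> word_class R w" by (simp add: word_class_def word_cong_def)
    then have "(SOME v. v \<in> word_class R w) \<in> word_class R w" by (rule someI)
    then have "(w, SOME v. v \<in> word_class R w) \<in> word_cong R" by (simp add: word_class_def)
    from word_cong_word_prod[OF assms(1) this that assms(2) f rel] show ?thesis
      by (simp add: h_def)
  qed
  have "h \<in> hom (word_monoid A R) K"
  proof (rule homI)
    fix P assume "P \<in> carrier (word_monoid A R)"
    then obtain w where "w \<in> lists A" "P = word_class R w" by (auto simp: carrier_word_monoid)
    then show "h P \<in> carrier K" by (auto simp: h intro!: K.word_prod_closed f)
  next
    fix P Q assume "P \<in> carrier (word_monoid A R)" "Q \<in> carrier (word_monoid A R)"
    then obtain u v where uv: "u \<in> lists A" "P = word_class R u" "v \<in> lists A" "Q = word_class R v"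
      by (auto simp: carrier_word_monoid)
    then have "h (P \<otimes>\<^bsub>word_monoid A R\<^esub> Q) = word_prod K f (u @ v)"
      by (simp add: word_monoid_mult h)
    also have "\<dots> = h P \<otimes>\<^bsub>K\<^esub> h Q"
      using uv f by (subst K.word_prod_append) (auto simp: h)
    finally show "h (P \<otimes>\<^bsub>word_monoid A R\<^esub> Q) = h P \<otimes>\<^bsub>K\<^esub> h Q" .
  qed
  with h show thesis by (rule that[rotated])
qed

lemma word_monoid_generated:
  assumes "group (word_monoid A R)"
  shows "carrier (word_monoid A R) = generate (word_monoid A R) ((\<lambda>x. word_class R [x]) ` A)"
    (is "_ = generate ?M ?L")
proof
  interpret group ?M by fact
  have L: "?L \<subseteq> carrier ?M" by (auto simp: carrier_word_monoid)
  then show "generate ?M ?L \<subseteq> carrier ?M" by (rule generate_incl)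
  have "word_class R w \<in> generate ?M ?L" if "w \<in> lists A" for w
    using that
  proof (induction w)
    case Nil
    show ?case using generate.one[of ?M ?L] by (simp only: one_word_monoid)
  next
    case (Cons x w)
    have "word_class R (x # w) = word_class R [x] \<otimes>\<^bsub>?M\<^esub> word_class R w"
      by (simp add: word_monoid_mult)
    then show ?case using Cons by (auto intro: generate.eng generate.incl)
  qed
  then show "carrier ?M \<subseteq> generate ?M ?L" by (auto simp: carrier_word_monoid)
qed

lemma free_gen_closed: "x \<in> S \<Longrightarrow> free_gen S x \<in> carrier (free_group S)"
  by (simp add: free_gen_def free_group_def carrier_word_monoid)

lemma free_group_universal:
  assumes "group K" and g: "\<And>x. x \<in> S \<Longrightarrow> g x \<in> carrier K"
  obtains h where "h \<in> hom (free_group S) K" and "\<And>x. x \<in> S \<Longrightarrow> h (free_gen S x) = g x"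
proof -
  interpret K: group K by fact
  define f where "f = (\<lambda>(x, b). if b then g x else inv\<^bsub>K\<^esub> g x)"
  have f: "f y \<in> carrier K" if "y \<in> S \<times> UNIV" for y
    using that g by (auto simp: f_def)
  have rel: "word_prod K f l = word_prod K f r" if "(l, r) \<in> free_group_rels S" for l r
    using that g by (auto simp: free_group_rels_def f_def)
  have R: "free_group_rels S \<subseteq> lists (S \<times> UNIV) \<times> lists (S \<times> UNIV)"
    by (auto simp: free_group_rels_def)
  obtain h where h: "h \<in> hom (free_group S) K"
    "\<And>w. w \<in> lists (S \<times> UNIV) \<Longrightarrow> h (word_class (free_group_rels S) w) = word_prod K f w"
    unfolding free_group_def using word_monoid_universal[OF K.monoid_axioms R f rel] by blast
  then have "h (free_gen S x) = g x" if "x \<in> S" for x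
    using that g by (simp add: free_gen_def f_def)
  with h(1) show thesis by (rule that)
qed

text \<open>
  The letter \<open>(x, False)\<close> is the inverse of a free generator, so the classes of all letters lie in the
  subgroup generated by the positive ones.
\<close>

lemma free_group_generated:
  "carrier (free_group S) = generate (free_group S) (free_gen S ` S)" (is "_ = generate ?F ?L")
proof
  interpret group ?F by (rule group_free_group)
  show "generate ?F ?L \<subseteq> carrier ?F" by (rule generate_incl) (auto simp: free_gen_closed)
  let ?c = "\<lambda>y. word_class (free_group_rels S) [y]"
  have "?c ` (S \<times> UNIV) \<subseteq> generate ?F ?L"
  proof clarify
    fix x b assume x: "x \<in> S"
    have "([(x, False), (x, True)], []) \<in> free_group_rels S"
      using x by (force simp: free_group_rels_def)
    then have "?c (x, False) \<otimes>\<^bsub>?F\<^esub> ?c (x, True) = \<one>\<^bsub>?F\<^esub>"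
      by (simp add: free_group_def word_monoid_mult one_word_monoid word_class_eq_iff word_cong_rel)
    then have "?c (x, False) = inv\<^bsub>?F\<^esub> free_gen S x"
      unfolding free_gen_def using x
      by (intro inv_equality[symmetric]) (auto simp: free_group_def carrier_word_monoid)
    then show "?c (x, b) \<in> generate ?F ?L"
      using x by (cases b) (auto simp: free_gen_def[symmetric] intro: generate.incl generate.inv)
  qed
  moreover have "subgroup (generate ?F ?L) ?F"
    by (rule generate_is_subgroup) (auto simp: free_gen_closed)
  ultimately have "generate ?F (?c ` (S \<times> UNIV)) \<subseteq> generate ?F ?L"
    by (rule generate_subgroup_incl)
  then show "carrier ?F \<subseteq> generate ?F ?L"
    using word_monoid_generated[of "S \<times> UNIV" "free_group_rels S"] group_free_group[of S]
    by (simp add: free_group_def)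
qed

lemma free_product_inl_hom:
  assumes "group G" "group H"
  shows "free_product_inl G H \<in> hom G (free_product G H)"
proof (rule homI)
  fix a b assume "a \<in> carrier G" "b \<in> carrier G"
  then have "([Inl a, Inl b], [Inl (a \<otimes>\<^bsub>G\<^esub> b)]) \<in> free_product_rels G H"
    unfolding free_product_rels_def by blast
  from word_cong_rel[OF this]
  show "free_product_inl G H (a \<otimes>\<^bsub>G\<^esub> b)
      = free_product_inl G H a \<otimes>\<^bsub>free_product G H\<^esub> free_product_inl G H b"
    by (simp add: free_product_inl_def free_product_def word_monoid_mult flip: word_class_eq_iff)
qed (auto simp: free_product_inl_def free_product_def carrier_word_monoid intro!: imageI)

lemma free_product_inr_hom:
  assumes "group G" "group H"
  shows "free_product_inr G H \<in> hom H (free_product G H)"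
proof (rule homI)
  fix a b assume "a \<in> carrier H" "b \<in> carrier H"
  then have "([Inr a, Inr b], [Inr (a \<otimes>\<^bsub>H\<^esub> b)]) \<in> free_product_rels G H"
    unfolding free_product_rels_def by blast
  from word_cong_rel[OF this]
  show "free_product_inr G H (a \<otimes>\<^bsub>H\<^esub> b)
      = free_product_inr G H a \<otimes>\<^bsub>free_product G H\<^esub> free_product_inr G H b"
    by (simp add: free_product_inr_def free_product_def word_monoid_mult flip: word_class_eq_iff)
qed (auto simp: free_product_inr_def free_product_def carrier_word_monoid intro!: imageI)

lemma free_product_universal:
  assumes "group G" "group H" "group K" and g: "g \<in> hom G K" and k: "k \<in> hom H K"
  obtains h where "h \<in> hom (free_product G H) K"
    and "\<And>a. a \<in> carrier G \<Longrightarrow> h (free_product_inl G H a) = g a"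
    and "\<And>b. b \<in> carrier H \<Longrightarrow> h (free_product_inr G H b) = k b"
proof -
  interpret K: group K by fact
  interpret G: group G by fact
  interpret H: group H by fact
  interpret g: group_hom G K g using g by unfold_locales
  interpret k: group_hom H K k using k by unfold_locales
  let ?A = "carrier G <+> carrier H"
  have f: "case_sum g k y \<in> carrier K" if "y \<in> ?A" for y
    using that by auto
  have rel: "word_prod K (case_sum g k) l = word_prod K (case_sum g k) r"
    if "(l, r) \<in> free_product_rels G H" for l r
    using that by (auto simp: free_product_rels_def)
  have R: "free_product_rels G H \<subseteq> lists ?A \<times> lists ?A"
    by (auto simp: free_product_rels_def)
  obtain h where h: "h \<in> hom (free_product G H) K"
    "\<And>w. w \<in> lists ?A \<Longrightarrow> h (word_class (free_product_rels G H) w) = word_prod K (case_sum g k) w"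
    unfolding free_product_def using word_monoid_universal[OF K.monoid_axioms R f rel] by blast
  show thesis
    by (rule that[OF h(1)]) (simp_all add: free_product_inl_def free_product_inr_def h(2) InlI InrI)
qed

lemma free_product_generated:
  assumes "group G" "group H"
  shows "carrier (free_product G H) = generate (free_product G H)
    (free_product_inl G H ` carrier G \<union> free_product_inr G H ` carrier H)"
proof -
  have "(\<lambda>y. word_class (free_product_rels G H) [y]) ` (carrier G <+> carrier H)
      = free_product_inl G H ` carrier G \<union> free_product_inr G H ` carrier H"
    by (simp add: Plus_def image_Un image_image free_product_inl_def free_product_inr_def)
  then show ?thesis
    using word_monoid_generated[OF group_free_product[OF assms, unfolded free_product_def]]
    by (simp add: free_product_def)
qed

lemma group_relators_closed:
  assumes "group G" and "R \<subseteq> carrier G \<times> carrier G"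
  shows "group_relators G R \<subseteq> carrier G"
proof -
  interpret group G by fact
  show ?thesis using assms(2) by (auto simp: group_relators_def)
qed

lemma quotient_class_hom:
  assumes "group G" and "R \<subseteq> carrier G \<times> carrier G"
  shows "quotient_class G R \<in> hom G (quotient_by_rels G R)"
  unfolding quotient_class_def[abs_def] quotient_by_rels_def
  by (rule normal.r_coset_hom_Mod normal_normal_closure assms group_relators_closed)+

lemma group_quotient_by_rels:
  assumes "group G" and "R \<subseteq> carrier G \<times> carrier G"
  shows "group (quotient_by_rels G R)"
  unfolding quotient_by_rels_def
  by (rule normal.factorgroup_is_group normal_normal_closure assms group_relators_closed)+

lemma carrier_quotient_by_rels:
  "carrier (quotient_by_rels G R) = quotient_class G R ` carrier G"
  by (simp add: quotient_by_rels_def quotient_class_def carrier_FactGroup)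

text \<open>
  The relator \<open>u v\<^sup>-\<^sup>1\<close> is in the normal closure, so \<open>u\<close> and \<open>v\<close> have the same coset.
\<close>

lemma quotient_class_eq:
  assumes "group G" and R: "R \<subseteq> carrier G \<times> carrier G" and uv: "(u, v) \<in> R"
  shows "quotient_class G R u = quotient_class G R v"
proof -
  interpret group G by fact
  let ?N = "normal_closure G (group_relators G R)"
  have N: "?N \<lhd> G" using assms by (intro normal_normal_closure group_relators_closed)
  have c: "u \<in> carrier G" "v \<in> carrier G" using R uv by auto
  have "u \<otimes>\<^bsub>G\<^esub> inv\<^bsub>G\<^esub> v \<in> ?N"
    using uv by (auto simp: normal_closure_def group_relators_def)
  then have "u \<in> ?N #>\<^bsub>G\<^esub> v"
    using c unfolding r_coset_def by (force simp: m_assoc)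
  then show ?thesis unfolding quotient_class_def
    using repr_independence[OF _ c(2) normal_imp_subgroup[OF N]] by simp
qed

text \<open>
  The kernel of \<^term>\<open>f\<close> is a normal subgroup that contains the relators, hence their normal closure.
\<close>

lemma quotient_by_rels_universal:
  assumes "group G" "group K" and R: "R \<subseteq> carrier G \<times> carrier G" and f: "f \<in> hom G K"
    and rel: "\<And>u v. (u, v) \<in> R \<Longrightarrow> f u = f v"
  obtains h where "h \<in> hom (quotient_by_rels G R) K"
    and "\<And>x. x \<in> carrier G \<Longrightarrow> h (quotient_class G R x) = f x"
proof -
  interpret G: group G by fact
  interpret K: group K by fact
  interpret f: group_hom G K f using f by unfold_locales
  have "group_relators G R \<subseteq> kernel G K f"
  proof
    fix x assume "x \<in> group_relators G R"
    then obtain u v where uv: "(u, v) \<in> R" "x = u \<otimes>\<^bsub>G\<^esub> inv\<^bsub>G\<^esub> v"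
      by (auto simp: group_relators_def)
    then have "u \<in> carrier G" "v \<in> carrier G" using R by auto
    with uv rel[OF uv(1)] show "x \<in> kernel G K f" by (simp add: kernel_def)
  qed
  then have "normal_closure G (group_relators G R) \<subseteq> kernel G K f"
    unfolding normal_closure_def using f.normal_kernel by blast
  then show thesis
    using f.FactGroup_universal_kernel[OF normal_normal_closure[OF assms(1) group_relators_closed[OF assms(1) R]]]
      that unfolding quotient_by_rels_def quotient_class_def by blast
qed

section \<open>Coxeter relations modulo a subgroup\<close>

text \<open>
  All self-maps of a type under composition. Lemmas on words in a monoid specialize to this monoid, so
  that one and the same argument serves for group elements and for the permutations below them.
\<close>

definition sym_monoid :: "('x \<Rightarrow> 'x) monoid" where
  "sym_monoid = \<lparr>carrier = UNIV, monoid.mult = (\<circ>), monoid.one = id\<rparr>"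

lemma monoid_sym_monoid: "monoid sym_monoid"
  by unfold_locales (auto simp: sym_monoid_def)

definition adjacent_swap :: "nat \<Rightarrow> nat \<Rightarrow> nat" where
  "adjacent_swap i = Transposition.transpose i (Suc i)"

definition word_perm :: "nat list \<Rightarrow> nat \<Rightarrow> nat" where
  "word_perm = word_prod sym_monoid adjacent_swap"

lemma word_perm_Nil [simp]: "word_perm [] = id"
  and word_perm_Cons [simp]: "word_perm (i # w) = adjacent_swap i \<circ> word_perm w"
  by (simp_all add: word_perm_def sym_monoid_def)

lemma word_perm_append: "word_perm (u @ v) = word_perm u \<circ> word_perm v"
  by (induction u) (simp_all add: o_assoc)

text \<open>
  The word \<open>[k, k - 1, \<dots>, j]\<close>, empty for \<open>j = k + 1\<close>. For \<open>j \<le> k + 1\<close> these words stand for the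
  minimal right coset representatives of the symmetric group on \<open>{0, \<dots>, k}\<close> in the one on
  \<open>{0, \<dots>, k + 1}\<close>: the representative of \<open>j\<close> is the one that sends \<open>j\<close> to \<open>k + 1\<close>.
\<close>

definition descent :: "nat \<Rightarrow> nat \<Rightarrow> nat list" where
  "descent k j = rev [j..<Suc k]"

lemma set_descent: "set (descent k j) = {j..k}"
  by (auto simp: descent_def)

lemma descent_empty [simp]: "descent k (Suc k) = []"
  by (simp add: descent_def)

lemma descent_snoc: "j \<le> k \<Longrightarrow> descent k j = descent k (Suc j) @ [j]"
  by (simp add: descent_def upt_rec)

lemma descent_append: "j \<le> i \<Longrightarrow> i \<le> Suc k \<Longrightarrow> descent k j = descent k i @ rev [j..<i]"
  using upt_add_eq_append[of j i "Suc k - i"] by (simp add: descent_def del: upt_Suc)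

lemma word_perm_fixes: "set w \<subseteq> {..<k} \<Longrightarrow> k < x \<Longrightarrow> word_perm w x = x"
  by (induction w) (auto simp: adjacent_swap_def Transposition.transpose_def)

lemma word_perm_descent: "j \<le> Suc k \<Longrightarrow> word_perm (descent k j) j = Suc k"
proof (induction rule: inc_induct)
  case (step j)
  then show ?case
    by (simp add: descent_snoc[of j k] word_perm_append adjacent_swap_def)
qed simp

text \<open>
  Only the braid relations are required, in a monoid and without any condition on the squares: this is
  the part of the relations that holds exactly for the \<open>\<sigma>\<^sub>i\<close> as well as for the adjacent transpositions.
\<close>

locale braid_family = monoid G for G :: "('g, 'c) monoid_scheme" (structure) +
  fixes a :: "nat \<Rightarrow> 'g" and K :: nat
  assumes gen_closed: "i < K \<Longrightarrow> a i \<in> carrier G"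
    and far: "\<lbrakk>i < K; j < K; j + 1 < i\<rbrakk> \<Longrightarrow> a i \<otimes> a j = a j \<otimes> a i"
    and braid: "i + 1 < K \<Longrightarrow> a i \<otimes> a (i + 1) \<otimes> a i = a (i + 1) \<otimes> a i \<otimes> a (i + 1)"
begin

lemma word_closed: "set w \<subseteq> {..<K} \<Longrightarrow> word_prod G a w \<in> carrier G"
  using gen_closed by (intro word_prod_closed) auto

lemma word_append:
  "\<lbrakk>set u \<subseteq> {..<K}; set v \<subseteq> {..<K}\<rbrakk> \<Longrightarrow>
    word_prod G a (u @ v) = word_prod G a u \<otimes> word_prod G a v"
  using gen_closed by (intro word_prod_append) auto

lemma far_word:
  assumes "set w \<subseteq> {..<K}" "i < K" "\<And>j. j \<in> set w \<Longrightarrow> j + 1 < i \<or> i + 1 < j"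
  shows "word_prod G a w \<otimes> a i = a i \<otimes> word_prod G a w"
  using assms
proof (induction w)
  case Nil
  then show ?case using gen_closed by simp
next
  case (Cons j w)
  have c: "a i \<in> carrier G" "a j \<in> carrier G" "word_prod G a w \<in> carrier G"
    using Cons.prems gen_closed word_closed by auto
  have IH: "word_prod G a w \<otimes> a i = a i \<otimes> word_prod G a w" using Cons by auto
  have "a j \<otimes> a i = a i \<otimes> a j"
    using far[of i j] far[of j i] Cons.prems(1,2) Cons.prems(3)[of j] by auto
  then show ?case using c IH by (simp add: m_assoc) (simp flip: m_assoc)
qed

text \<open>
  The letter \<open>i\<close> is moved leftwards through \<open>[k, \<dots>, i + 1, i, i - 1, \<dots>, j]\<close>. It commutes with the letters
  below \<open>i - 1\<close>, then one braid relation turns \<open>i, i - 1, i\<close> into \<open>i - 1, i, i - 1\<close>, and the new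
  leading letter \<open>i - 1\<close> commutes with the letters above \<open>i\<close>.
\<close>

lemma descent_mult_braid:
  assumes "j < i" "i \<le> k" "k < K"
  shows "word_prod G a (descent k j) \<otimes> a i = a (i - 1) \<otimes> word_prod G a (descent k j)"
proof -
  obtain l where i: "i = Suc l" using assms by (cases i) auto
  define u where "u = descent k (Suc i)"
  define v where "v = rev [j..<l]"
  have w: "descent k j = u @ [i, l] @ v"
    using assms descent_append[of j "Suc i" k] by (simp add: u_def v_def i)
  have u: "set u \<subseteq> {..<K}" "\<And>x. x \<in> set u \<Longrightarrow> l + 1 < x"
    using assms by (auto simp: u_def set_descent i)
  have v: "set v \<subseteq> {..<K}" "\<And>x. x \<in> set v \<Longrightarrow> x + 1 < i"
    using assms by (auto simp: v_def i)
  let ?U = "word_prod G a u" and ?V = "word_prod G a v"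
  have c: "a i \<in> carrier G" "a l \<in> carrier G" "?U \<in> carrier G" "?V \<in> carrier G"
    using gen_closed assms i word_closed u v by auto
  have lK: "l < K" "i < K" using assms i by auto
  have W: "word_prod G a (descent k j) = ?U \<otimes> (a i \<otimes> (a l \<otimes> ?V))"
    unfolding w using u v lK by (subst word_append) auto
  have "word_prod G a (descent k j) \<otimes> a i = ?U \<otimes> (a i \<otimes> (a l \<otimes> (?V \<otimes> a i)))"
    unfolding W using c by (simp add: m_assoc)
  also have "?V \<otimes> a i = a i \<otimes> ?V" using far_word[OF v(1) lK(2)] v(2) by blast
  also have "?U \<otimes> (a i \<otimes> (a l \<otimes> (a i \<otimes> ?V))) = ?U \<otimes> ((a i \<otimes> a l \<otimes> a i) \<otimes> ?V)"
    using c by (simp add: m_assoc)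
  also have "a i \<otimes> a l \<otimes> a i = a l \<otimes> a i \<otimes> a l" using braid[of l] lK i by simp
  also have "?U \<otimes> ((a l \<otimes> a i \<otimes> a l) \<otimes> ?V) = (?U \<otimes> a l) \<otimes> (a i \<otimes> (a l \<otimes> ?V))"
    using c by (simp add: m_assoc)
  also have "?U \<otimes> a l = a l \<otimes> ?U" using far_word[OF u(1) lK(1)] u(2) by blast
  also have "(a l \<otimes> ?U) \<otimes> (a i \<otimes> (a l \<otimes> ?V)) = a l \<otimes> word_prod G a (descent k j)"
    unfolding W using c by (simp add: m_assoc)
  finally show ?thesis by (simp add: i)
qed

end

lemma braid_family_adjacent_swap: "braid_family sym_monoid adjacent_swap K"
proof -
  interpret monoid sym_monoid by (rule monoid_sym_monoid)
  show ?thesis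
    by unfold_locales
      (auto simp: sym_monoid_def adjacent_swap_def fun_eq_iff Transposition.transpose_def)
qed

text \<open>
  The Coxeter relations of a symmetric group, with \<open>a\<^sub>i\<^sup>2 = 1\<close> weakened to \<open>a\<^sub>i\<^sup>2 \<in> N\<close>, for a
  subgroup \<open>N\<close> that can be moved past the \<open>a\<^sub>i\<close>. Stating this in \<open>G\<close> instead of a quotient by \<open>N\<close>
  avoids cosets altogether.
\<close>

locale coxeter_mod_subgroup = braid_family G a K + group G + N: subgroup N G
  for G :: "('g, 'c) monoid_scheme" (structure) and a :: "nat \<Rightarrow> 'g" and K :: nat and N :: "'g set" +
  assumes square: "i < K \<Longrightarrow> a i \<otimes> a i \<in> N"
    and past: "\<lbrakk>i < K; t \<in> N\<rbrakk> \<Longrightarrow> \<exists>t'\<in>N. t \<otimes> a i = a i \<otimes> t'"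
begin

text \<open>
  The products \<open>v d t\<close>, where \<open>v\<close> is a word in the letters below \<open>k\<close>, \<open>d\<close> a descent from \<open>k\<close> and
  \<open>t \<in> N\<close>, are closed under right multiplication by each \<open>a\<^sub>i\<close> with \<open>i \<le> k\<close>. First \<open>t\<close> is moved to the
  right; then \<open>a\<^sub>i\<close> extends the descent, cancels its last letter up to an element of \<open>N\<close>, or slides
  through it into \<open>v\<close>. The permutations undergo the same rewriting, which is why both equations
  are proved with common witnesses.
\<close>

lemma coset_normal_form:
  assumes "set w \<subseteq> {..<Suc k}" "k < K"
  shows "\<exists>v j. \<exists>t\<in>N. set v \<subseteq> {..<k} \<and> j \<le> Suc k
    \<and> word_prod G a w = word_prod G a (v @ descent k j) \<otimes> t
    \<and> word_perm w = word_perm (v @ descent k j)"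
  using assms(1)
proof (induction w rule: rev_induct)
  case Nil
  have "set [] \<subseteq> {..<k} \<and> Suc k \<le> Suc k
    \<and> word_prod G a [] = word_prod G a ([] @ descent k (Suc k)) \<otimes> \<one>
    \<and> word_perm [] = word_perm ([] @ descent k (Suc k))" by simp
  then show ?case using N.one_closed by blast
next
  case (snoc i w)
  interpret S: braid_family sym_monoid adjacent_swap K by (rule braid_family_adjacent_swap)
  obtain v j t where IH: "t \<in> N" "set v \<subseteq> {..<k}" "j \<le> Suc k"
    "word_prod G a w = word_prod G a (v @ descent k j) \<otimes> t"
    "word_perm w = word_perm (v @ descent k j)"
    using snoc by auto
  have i: "i \<le> k" "i < K" using snoc.prems assms by auto
  obtain t' where t': "t' \<in> N" "t \<otimes> a i = a i \<otimes> t'" using past[OF i(2) IH(1)] by blast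
  let ?D = "\<lambda>j. word_prod G a (descent k j)" and ?V = "word_prod G a v"
  have d: "set (descent k j') \<subseteq> {..<K}" for j' using assms(2) by (auto simp: set_descent)
  have vK: "set v \<subseteq> {..<K}" and wK: "set w \<subseteq> {..<K}" using IH(2) snoc.prems assms(2) by auto
  have c: "a x \<in> carrier G" "?D j' \<in> carrier G" "?V \<in> carrier G" "t \<in> carrier G" "t' \<in> carrier G"
    if "x < K" for x j'
    using that gen_closed word_closed d vK IH(1) t'(1) by auto
  have G: "word_prod G a (w @ [i]) = ?V \<otimes> (?D j \<otimes> a i) \<otimes> t'"
    using word_append[OF wK, of "[i]"] word_append[OF vK d] IH(4) t'(2) c[OF i(2)] i
    by (simp add: m_assoc)
  have P: "word_perm (w @ [i]) = word_perm v \<circ> (word_perm (descent k j) \<circ> adjacent_swap i)"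
    by (simp add: word_perm_append IH(5) o_assoc)
  \<comment> \<open>A letter that passes the descent, possibly changing its index, is absorbed by \<open>v\<close>.\<close>
  have slide: ?case
    if l: "l < k" and D: "?D j \<otimes> a i = a l \<otimes> ?D j"
      and D': "word_perm (descent k j) \<circ> adjacent_swap i = adjacent_swap l \<circ> word_perm (descent k j)"
    for l
  proof -
    have lK: "l < K" and v: "set (v @ [l]) \<subseteq> {..<k}" "set (v @ [l]) \<subseteq> {..<K}"
      using l IH(2) vK assms(2) by auto
    have "word_prod G a ((v @ [l]) @ descent k j) = ?V \<otimes> a l \<otimes> ?D j"
      using word_append[OF v(2) d] word_append[OF vK, of "[l]"] lK c[OF lK] by simp
    then have "word_prod G a (w @ [i]) = word_prod G a ((v @ [l]) @ descent k j) \<otimes> t'"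
      unfolding G D using c[OF lK] by (simp add: m_assoc)
    moreover have "word_perm (w @ [i]) = word_perm ((v @ [l]) @ descent k j)"
      unfolding P D' by (simp add: word_perm_append o_assoc)
    ultimately show ?thesis using v(1) IH(3) t'(1) by meson
  qed
  consider "j = Suc i" | "j = i" | "Suc i < j" | "j < i" by linarith
  then show ?case
  proof cases
    case 1
    have "?D i = ?D j \<otimes> a i"
      using word_append[OF d, of "[i]" j] descent_snoc[OF i(1)] i c[OF i(2)] 1 by simp
    moreover have "word_perm (descent k i) = word_perm (descent k j) \<circ> adjacent_swap i"
      using descent_snoc[OF i(1)] 1 by (simp add: word_perm_append)
    ultimately have "word_prod G a (w @ [i]) = word_prod G a (v @ descent k i) \<otimes> t'"
      "word_perm (w @ [i]) = word_perm (v @ descent k i)"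
      unfolding G P word_append[OF vK d] by (simp_all add: word_perm_append)
    then show ?thesis using IH(2) t'(1) i by (meson le_SucI)
  next
    case 2
    have "?D i = ?D (Suc i) \<otimes> a i"
      using word_append[OF d, of "[i]" "Suc i"] descent_snoc[OF i(1)] i c[OF i(2)] by simp
    then have "word_prod G a (w @ [i]) = word_prod G a (v @ descent k (Suc i)) \<otimes> (a i \<otimes> a i \<otimes> t')"
      unfolding G word_append[OF vK d] using c[OF i(2)] 2 by (simp add: m_assoc)
    moreover have "word_perm (descent k i) = word_perm (descent k (Suc i)) \<circ> adjacent_swap i"
      using descent_snoc[OF i(1)] by (simp add: word_perm_append)
    then have "word_perm (w @ [i]) = word_perm (v @ descent k (Suc i))"
      unfolding P 2 by (simp add: word_perm_append o_assoc[symmetric] adjacent_swap_def)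
    moreover have "a i \<otimes> a i \<otimes> t' \<in> N" using square[OF i(2)] t'(1) by simp
    ultimately show ?thesis using IH(2) i by (meson Suc_le_mono)
  next
    case 3
    have far: "x + 1 < i \<or> i + 1 < x" if "x \<in> set (descent k j)" for x
      using that 3 by (auto simp: set_descent)
    have "?D j \<otimes> a i = a i \<otimes> ?D j" using far_word[OF d i(2) far] .
    moreover have "word_perm (descent k j) \<circ> adjacent_swap i = adjacent_swap i \<circ> word_perm (descent k j)"
      using S.far_word[OF d i(2) far] by (simp add: word_perm_def sym_monoid_def)
    ultimately show ?thesis using slide[of i] 3 IH(3) by simp
  next
    case 4
    have "?D j \<otimes> a i = a (i - 1) \<otimes> ?D j" using descent_mult_braid[OF 4 i(1) assms(2)] .
    moreover have "word_perm (descent k j) \<circ> adjacent_swap i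
        = adjacent_swap (i - 1) \<circ> word_perm (descent k j)"
      using S.descent_mult_braid[OF 4 i(1) assms(2)] by (simp add: word_perm_def sym_monoid_def)
    ultimately show ?thesis using slide[of "i - 1"] 4 i by simp
  qed
qed

text \<open>
  Injectivity of the Coxeter presentation of the symmetric group, relative to \<open>N\<close>. In the normal form,
  the descent sends \<open>j\<close> to \<open>k + 1\<close> and the remaining word fixes \<open>k + 1\<close>. If the permutation is
  trivial then \<open>j = k + 1\<close>, so the descent is empty and the word only involves letters below \<open>k\<close>.
\<close>

theorem word_perm_id_imp_mem:
  assumes "set w \<subseteq> {..<k}" "k \<le> K" "word_perm w = id"
  shows "word_prod G a w \<in> N"
  using assms
proof (induction k arbitrary: w)
  case (Suc k)
  then obtain v j t where nf: "t \<in> N" "set v \<subseteq> {..<k}" "j \<le> Suc k"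
    "word_prod G a w = word_prod G a (v @ descent k j) \<otimes> t"
    "word_perm w = word_perm (v @ descent k j)"
    using coset_normal_form[of w k] by auto
  have "word_perm w j = Suc k"
    using nf(2,3,5) word_perm_descent word_perm_fixes[of v k "Suc k"] by (simp add: word_perm_append)
  then have "j = Suc k" using Suc.prems(3) by simp
  then have "word_perm v = id" "word_prod G a w = word_prod G a v \<otimes> t"
    using nf(4,5) Suc.prems(3) by (metis append_Nil2 descent_empty)+
  then show ?case using Suc.IH[of v] nf(1,2) Suc.prems(2) by simp
qed simp

lemma word_past:
  assumes "set w \<subseteq> {..<K}" "t \<in> N"
  shows "\<exists>t'\<in>N. t \<otimes> word_prod G a w = word_prod G a w \<otimes> t'"
  using assms
proof (induction w arbitrary: t)
  case Nil
  then show ?case by auto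
next
  case (Cons i w)
  obtain u where u: "u \<in> N" "t \<otimes> a i = a i \<otimes> u" using past[of i t] Cons.prems by auto
  obtain t' where t': "t' \<in> N" "u \<otimes> word_prod G a w = word_prod G a w \<otimes> t'"
    using Cons.IH[of u] Cons.prems u(1) by auto
  have c: "a i \<in> carrier G" "word_prod G a w \<in> carrier G" "t \<in> carrier G" "u \<in> carrier G" "t' \<in> carrier G"
    using Cons.prems gen_closed word_closed u(1) t'(1) by auto
  have "t \<otimes> word_prod G a (i # w) = a i \<otimes> (u \<otimes> word_prod G a w)"
    using c u(2) by (simp flip: m_assoc)
  also have "\<dots> = word_prod G a (i # w) \<otimes> t'" unfolding t'(2) using c by (simp add: m_assoc)
  finally show ?case using t'(1) by blast
qed

text \<open>
  The set of all products \<open>w t\<close> is stable under left multiplication by \<open>N\<close>, by the \<open>a\<^sub>i\<close> and, as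
  \<open>a\<^sub>i\<^sup>-\<^sup>1 = a\<^sub>i (a\<^sub>i\<^sup>2)\<^sup>-\<^sup>1\<close>, by their inverses. It contains \<open>1\<close>, hence the whole generated subgroup.
\<close>

lemma generated_factorization:
  assumes "g \<in> generate G (a ` {..<K} \<union> N)"
  obtains w t where "set w \<subseteq> {..<K}" "t \<in> N" "g = word_prod G a w \<otimes> t"
proof -
  define X where "X = {word_prod G a w \<otimes> t | w t. set w \<subseteq> {..<K} \<and> t \<in> N}"
  have XI: "word_prod G a w \<otimes> t \<in> X" if "set w \<subseteq> {..<K}" "t \<in> N" for w t
    using that by (auto simp: X_def)
  have X: "X \<subseteq> carrier G" using word_closed by (auto simp: X_def)
  have N: "t \<otimes> x \<in> X" if tN: "t \<in> N" and xX: "x \<in> X" for t x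
  proof -
    obtain w u where x: "set w \<subseteq> {..<K}" "u \<in> N" "x = word_prod G a w \<otimes> u"
      using xX by (auto simp: X_def)
    obtain t' where t': "t' \<in> N" "t \<otimes> word_prod G a w = word_prod G a w \<otimes> t'"
      using word_past[OF x(1) tN] by blast
    have "t \<otimes> x = word_prod G a w \<otimes> (t' \<otimes> u)"
      using x t' tN word_closed[OF x(1)] by (simp flip: m_assoc)
    then show ?thesis using XI[OF x(1), of "t' \<otimes> u"] t'(1) x(2) by simp
  qed
  have A: "a i \<otimes> x \<in> X" if i: "i < K" and xX: "x \<in> X" for i x
  proof -
    obtain w u where x: "set w \<subseteq> {..<K}" "u \<in> N" "x = word_prod G a w \<otimes> u"
      using xX by (auto simp: X_def)
    then have "a i \<otimes> x = word_prod G a (i # w) \<otimes> u"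
      using word_closed[OF x(1)] gen_closed[OF i] by (simp add: m_assoc)
    then show ?thesis using XI[of "i # w" u] x i by simp
  qed
  have A': "inv (a i) \<otimes> x \<in> X" if i: "i < K" and x: "x \<in> X" for i x
  proof -
    have c: "a i \<in> carrier G" "x \<in> carrier G" using i x gen_closed X by auto
    have "inv (a i) \<otimes> x = a i \<otimes> (inv (a i \<otimes> a i) \<otimes> x)"
      using c by (simp add: inv_mult_group m_assoc[symmetric])
    then show ?thesis using A[OF i] N[OF _ x] square[OF i] by simp
  qed
  have gc: "generate G (a ` {..<K} \<union> N) \<subseteq> carrier G"
    using gen_closed by (intro generate_incl) auto
  have "\<forall>x\<in>X. g \<otimes> x \<in> X"
    using assms
  proof (induction rule: generate.induct)
    case one
    then show ?case using X by auto
  next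
    case (incl h)
    then show ?case using A N by auto
  next
    case (inv h)
    then show ?case using A' N by auto
  next
    case (eng h1 h2)
    then have "h1 \<in> carrier G" "h2 \<in> carrier G" using gc by auto
    then show ?case using eng.IH X by (auto simp: m_assoc subset_iff)
  qed
  moreover have "\<one> \<in> X" using XI[of "[]" "\<one>"] by simp
  moreover have "g \<in> carrier G" using assms gc by auto
  ultimately have "g \<in> X" by force
  then show thesis using that by (auto simp: X_def)
qed

end

section \<open>Monomial matrices\<close>

text \<open>
  The product of the permutation matrix of \<open>\<pi>\<close> with the diagonal matrix of \<open>d\<close>, in this order: the
  basis vector \<open>x\<^sub>c\<close> is sent to \<open>d(c) x\<^bsub>\<pi>(c)\<^esub>\<close>.
\<close>

definition monomial_mat :: "nat \<Rightarrow> (nat \<Rightarrow> nat) \<Rightarrow> (nat \<Rightarrow> complex) \<Rightarrow> complex mat" where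
  "monomial_mat n \<pi> d = mat n n (\<lambda>(r, c). if r = \<pi> c then d c else 0)"

lemma monomial_mat_carrier [simp]: "monomial_mat n \<pi> d \<in> carrier_mat n n"
  by (simp add: monomial_mat_def)

lemma monomial_mat_cong:
  "\<lbrakk>\<And>c. c < n \<Longrightarrow> \<pi> c = \<rho> c; \<And>c. c < n \<Longrightarrow> d c = e c\<rbrakk> \<Longrightarrow> monomial_mat n \<pi> d = monomial_mat n \<rho> e"
  unfolding monomial_mat_def by (rule eq_matI) auto

lemma monomial_mat_mult:
  assumes "\<And>c. c < n \<Longrightarrow> \<rho> c < n"
  shows "monomial_mat n \<pi> d * monomial_mat n \<rho> e = monomial_mat n (\<pi> \<circ> \<rho>) (\<lambda>c. d (\<rho> c) * e c)"
proof (rule eq_matI)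
  fix r c assume "r < dim_row (monomial_mat n (\<pi> \<circ> \<rho>) (\<lambda>c. d (\<rho> c) * e c))"
    "c < dim_col (monomial_mat n (\<pi> \<circ> \<rho>) (\<lambda>c. d (\<rho> c) * e c))"
  then have rc: "r < n" "c < n" by (simp_all add: monomial_mat_def)
  then have "(monomial_mat n \<pi> d * monomial_mat n \<rho> e) $$ (r, c)
      = (\<Sum>k\<in>{0..<n}. (if r = \<pi> k then d k else 0) * (if k = \<rho> c then e c else 0))"
    by (simp add: monomial_mat_def scalar_prod_def)
  also have "\<dots> = (\<Sum>k\<in>{0..<n}. if k = \<rho> c then (if r = \<pi> k then d k else 0) * e c else 0)"
    by (rule sum.cong) auto
  also have "\<dots> = monomial_mat n (\<pi> \<circ> \<rho>) (\<lambda>c. d (\<rho> c) * e c) $$ (r, c)"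
    using rc assms by (simp add: monomial_mat_def)
  finally show "(monomial_mat n \<pi> d * monomial_mat n \<rho> e) $$ (r, c)
      = monomial_mat n (\<pi> \<circ> \<rho>) (\<lambda>c. d (\<rho> c) * e c) $$ (r, c)" .
qed (simp_all add: monomial_mat_def)

lemma monomial_mat_perm_eq:
  assumes "monomial_mat n \<pi> d = monomial_mat n \<rho> e" "c < n" "\<pi> c < n" "d c \<noteq> 0"
  shows "\<pi> c = \<rho> c"
proof -
  have "monomial_mat n \<pi> d $$ (\<pi> c, c) = monomial_mat n \<rho> e $$ (\<pi> c, c)" using assms(1) by simp
  then show ?thesis using assms by (simp add: monomial_mat_def split: if_splits)
qed

lemma one_monomial_mat: "1\<^sub>m n = monomial_mat n id (\<lambda>_. 1)"
  by (rule eq_matI) (auto simp: monomial_mat_def)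

lemma diagonal_monomial_mat: "diagonal_mat (monomial_mat n id d)"
  by (simp add: diagonal_mat_def monomial_mat_def)

lemma diagonal_imp_monomial_mat:
  "A \<in> carrier_mat n n \<Longrightarrow> diagonal_mat A \<Longrightarrow> A = monomial_mat n id (\<lambda>c. A $$ (c, c))"
  by (rule eq_matI) (auto simp: monomial_mat_def diagonal_mat_def)

lemma permutes_less: "\<pi> permutes {0..<n} \<Longrightarrow> c < n \<Longrightarrow> \<pi> c < (n::nat)"
  using permutes_in_image[of \<pi> "{0..<n}" c] by simp

lemma monomial_mat_GL:
  assumes "\<pi> permutes {0..<n}" "\<And>c. c < n \<Longrightarrow> d c \<noteq> 0"
  shows "monomial_mat n \<pi> d \<in> carrier (GL n)"
proof -
  let ?i = "Hilbert_Choice.inv \<pi>"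
  have i: "?i permutes {0..<n}" using assms(1) by (rule permutes_inv)
  have "monomial_mat n \<pi> d * monomial_mat n ?i (\<lambda>c. inverse (d (?i c))) = 1\<^sub>m n"
    using permutes_less[OF i] assms permutes_inverses[OF assms(1)]
    unfolding one_monomial_mat
    by (subst monomial_mat_mult) (auto intro!: monomial_mat_cong)
  then have "det (monomial_mat n \<pi> d) * det (monomial_mat n ?i (\<lambda>c. inverse (d (?i c)))) = 1"
    using det_mult[OF monomial_mat_carrier monomial_mat_carrier] by (metis det_one)
  then show ?thesis by (auto simp: GL_iff_det)
qed

lemma monomial_mat_diag_pow:
  "monomial_mat n id d [^]\<^bsub>GL n\<^esub> (k :: nat) = monomial_mat n id (\<lambda>c. d c ^ k)"
proof (induction k)
  case 0
  interpret group "GL n" by (rule group_GL)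
  show ?case by (simp add: one_GL one_monomial_mat id_def)
next
  case (Suc k)
  interpret group "GL n" by (rule group_GL)
  show ?case unfolding nat_pow_Suc Suc mult_GL
    by (subst monomial_mat_mult) (auto intro!: monomial_mat_cong simp: mult.commute)
qed

lemma root_nonzero: "z ^ m = 1 \<Longrightarrow> m > 0 \<Longrightarrow> z \<noteq> (0 :: complex)"
  by (auto simp: power_0_left)

lemma T_group_iff:
  assumes "m > 0"
  shows "t \<in> T_group m p n \<longleftrightarrow>
    (\<exists>d. t = monomial_mat n id d \<and> (\<forall>c<n. d c ^ m = 1)) \<and> det t \<in> roots_of_unity (m div p)"
    (is "?l \<longleftrightarrow> ?r")
proof
  assume t: ?l
  define d where "d c = t $$ (c, c)" for c
  have "t \<in> carrier_mat n n" "diagonal_mat t"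
    using t by (auto simp: T_group_def diag_matrices_def GL_iff_det)
  then have td: "t = monomial_mat n id d"
    unfolding d_def by (rule diagonal_imp_monomial_mat)
  have "monomial_mat n id (\<lambda>c. d c ^ m) = monomial_mat n id (\<lambda>_. 1)"
    using t by (simp add: T_group_def td monomial_mat_diag_pow one_GL one_monomial_mat)
  then have eq: "monomial_mat n id (\<lambda>c. d c ^ m) $$ (c, c) = monomial_mat n id (\<lambda>_. 1) $$ (c, c)" for c
    by (simp only:)
  have "d c ^ m = 1" if "c < n" for c
    using eq[of c] that by (simp add: monomial_mat_def)
  then show ?r using t td by (auto simp: T_group_def)
next
  assume ?r
  then obtain d where d: "t = monomial_mat n id d" "\<And>c. c < n \<Longrightarrow> d c ^ m = 1"
    and D: "det t \<in> roots_of_unity (m div p)" by blast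
  have "t \<in> carrier (GL n)"
    unfolding d(1) using d(2) root_nonzero[OF _ assms] by (blast intro: monomial_mat_GL permutes_id)
  moreover have "t [^]\<^bsub>GL n\<^esub> m = \<one>\<^bsub>GL n\<^esub>"
    unfolding d(1) monomial_mat_diag_pow one_GL one_monomial_mat
    using d(2) by (intro monomial_mat_cong) auto
  ultimately show ?l using D
    by (simp add: T_group_def diag_matrices_def diagonal_monomial_mat d(1))
qed

lemma det_pow_GL:
  assumes "t \<in> carrier (GL n)"
  shows "det (t [^]\<^bsub>GL n\<^esub> (k :: nat)) = det t ^ k"
proof -
  interpret group "GL n" by (rule group_GL)
  show ?thesis using assms by (induction k) (simp_all add: det_one_GL det_mult_GL)
qed

text \<open>
  For \<open>p = 1\<close> the condition on the determinant is automatic, since the determinant is multiplicative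
  and \<open>t\<^sup>m = 1\<close>.
\<close>

lemma T_group_1_iff:
  assumes "m > 0"
  shows "t \<in> T_group m 1 n \<longleftrightarrow> (\<exists>d. t = monomial_mat n id d \<and> (\<forall>c<n. d c ^ m = 1))"
proof
  assume "\<exists>d. t = monomial_mat n id d \<and> (\<forall>c<n. d c ^ m = 1)"
  then obtain d where d: "t = monomial_mat n id d" "\<And>c. c < n \<Longrightarrow> d c ^ m = 1" by blast
  have "t \<in> carrier (GL n)"
    unfolding d(1) using d(2) root_nonzero[OF _ assms] by (blast intro: monomial_mat_GL permutes_id)
  then have "det t ^ m = det (t [^]\<^bsub>GL n\<^esub> m)" by (simp add: det_pow_GL)
  also have "t [^]\<^bsub>GL n\<^esub> m = \<one>\<^bsub>GL n\<^esub>"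
    unfolding d(1) monomial_mat_diag_pow one_GL one_monomial_mat
    using d(2) by (intro monomial_mat_cong) auto
  finally have "det t ^ m = 1" by (simp add: det_one_GL)
  then show "t \<in> T_group m 1 n" using d by (auto simp: T_group_iff[OF assms] roots_of_unity_def)
qed (simp add: T_group_iff[OF assms])

lemma perm_matrix_eq: "perm_matrix n \<pi> = monomial_mat n \<pi> (\<lambda>_. 1)"
  by (simp add: perm_matrix_def monomial_mat_def)

lemma mystic_group_iff:
  assumes "m > 0"
  shows "M \<in> mystic_group m p n \<longleftrightarrow>
    (\<exists>\<pi> d. \<pi> permutes {0..<n} \<and> (\<forall>c<n. d c ^ m = 1) \<and> M = monomial_mat n \<pi> d)
    \<and> det M \<in> roots_of_unity (m div p)" (is "?l \<longleftrightarrow> ?r")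
proof -
  have prod: "perm_matrix n \<pi> \<otimes>\<^bsub>GL n\<^esub> monomial_mat n id d = monomial_mat n \<pi> d" for \<pi> d
    by (simp add: perm_matrix_eq mult_GL monomial_mat_mult)
  show ?thesis
  proof
    assume ?l
    then show ?r
      unfolding mystic_group_def perm_matrices_def T_group_1_iff[OF assms] by (auto simp: prod) blast
  next
    assume ?r
    then obtain \<pi> d where M: "\<pi> permutes {0..<n}" "\<forall>c<n. d c ^ m = 1" "M = monomial_mat n \<pi> d"
      and D: "det M \<in> roots_of_unity (m div p)" by blast
    have "perm_matrix n \<pi> \<in> perm_matrices n" using M(1) by (auto simp: perm_matrices_def)
    moreover have "monomial_mat n id d \<in> T_group m 1 n"
      using M(2) unfolding T_group_1_iff[OF assms] by blast
    moreover have "M = perm_matrix n \<pi> \<otimes>\<^bsub>GL n\<^esub> monomial_mat n id d"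
      by (simp add: prod M(3))
    ultimately show ?l using D unfolding mystic_group_def by blast
  qed
qed

section \<open>Adjacent transpositions generate the symmetric group\<close>

lemma adjacent_swap_permutes: "Suc i < n \<Longrightarrow> adjacent_swap i permutes {0..<n}"
  unfolding adjacent_swap_def by (rule permutes_swap_id) auto

lemma word_perm_permutes: "set w \<subseteq> {..<n - 1} \<Longrightarrow> word_perm w permutes {0..<n}"
proof (induction w)
  case (Cons i w)
  then have "Suc i < n" and w: "word_perm w permutes {0..<n}" by auto
  then show ?case
    unfolding word_perm_Cons by (intro permutes_compose[OF w] adjacent_swap_permutes)
qed (auto intro: permutes_id)

text \<open>
  Conjugation of \<open>(a b)\<close> by the adjacent transposition \<open>(b b+1)\<close> gives \<open>(a b+1)\<close>.
\<close>

lemma transpose_eq_word_perm: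
  assumes "a < b" "b < n"
  shows "\<exists>w. set w \<subseteq> {..<n - 1} \<and> word_perm w = Transposition.transpose a b"
  using Suc_leI[OF assms(1)] assms(2)
proof (induction b rule: dec_induct)
  case base
  then have "set [a] \<subseteq> {..<n - 1} \<and> word_perm [a] = Transposition.transpose a (Suc a)"
    by (auto simp: adjacent_swap_def)
  then show ?case by blast
next
  case (step b)
  then obtain w where w: "set w \<subseteq> {..<n - 1}" "word_perm w = Transposition.transpose a b" by auto
  have "word_perm (b # w @ [b]) = Transposition.transpose a (Suc b)"
    using step.hyps unfolding word_perm_Cons word_perm_append w(2)
    by (auto simp: fun_eq_iff adjacent_swap_def Transposition.transpose_def)
  moreover have "set (b # w @ [b]) \<subseteq> {..<n - 1}" using w(1) step.prems by auto
  ultimately show ?case by blast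
qed

lemma permutation_eq_word_perm:
  assumes "\<pi> permutes {0..<n}"
  shows "\<exists>w. set w \<subseteq> {..<n - 1} \<and> word_perm w = \<pi>"
  using assms finite_atLeastLessThan
proof (induction rule: permutes_induct)
  case id
  have "set [] \<subseteq> {..<n - 1} \<and> word_perm [] = id" by simp
  then show ?case by blast
next
  case (swap a b \<pi>)
  then obtain w where w: "set w \<subseteq> {..<n - 1}" "word_perm w = \<pi>" by blast
  obtain v where v: "set v \<subseteq> {..<n - 1}" "word_perm v = Transposition.transpose a b"
    using transpose_eq_word_perm[of a b n] transpose_eq_word_perm[of b a n] swap(1-3)
    by (auto simp: transpose_commute neq_iff)
  have "set (v @ w) \<subseteq> {..<n - 1} \<and> word_perm (v @ w) = Transposition.transpose a b \<circ> \<pi>"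
    using v w by (simp add: word_perm_append)
  then show ?case by blast
qed

section \<open>The relations between the matrix generators\<close>

lemma sigma_elem_monomial:
  assumes "i < n - 1"
  shows "sigma_elem n i (i + 1) 1
    = monomial_mat n (adjacent_swap i) (\<lambda>c. if c = Suc i then - 1 else 1)"
  unfolding sigma_elem_def monomial_mat_def adjacent_swap_def Transposition.transpose_def
  by (rule eq_matI) auto

lemma s_elem_monomial: "s_elem n i (i + 1) = monomial_mat n (adjacent_swap i) (\<lambda>_. 1)"
  by (simp add: s_elem_def perm_matrix_eq adjacent_swap_def)

lemma t_elem_monomial: "t_elem n i \<epsilon> = monomial_mat n id (\<lambda>c. if c = i then \<epsilon> else 1)"
  unfolding t_elem_def monomial_mat_def by (rule eq_matI) auto

lemma det_t_elem: "i < n \<Longrightarrow> det (t_elem n i \<epsilon>) = \<epsilon>"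
proof -
  assume "i < n"
  moreover have "t_elem n i \<epsilon> = multrow_mat n i \<epsilon>"
    unfolding t_elem_def multrow_mat_def by (rule eq_matI) auto
  ultimately show ?thesis by (simp add: det_multrow_mat)
qed

lemma adjacent_swap_less: "i < n - 1 \<Longrightarrow> c < n \<Longrightarrow> adjacent_swap i c < n"
  by (auto simp: adjacent_swap_def Transposition.transpose_def)

lemma adjacent_swap_involutive [simp]: "adjacent_swap i (adjacent_swap i c) = c"
  by (simp add: adjacent_swap_def)

text \<open>
  The matrix \<open>\<sigma>\<^sub>i\<close> is the transposition of determinant \<open>-1\<close> times the diagonal reflection
  \<open>t\<^bsub>i+1\<^esub>\<^sup>(\<^sup>-\<^sup>1\<^sup>)\<close> of determinant \<open>-1\<close>.
\<close>

lemma det_sigma_elem: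
  assumes "i < n - 1"
  shows "det (sigma_elem n i (i + 1) 1) = 1"
proof -
  have "sigma_elem n i (i + 1) 1 = s_elem n i (i + 1) * t_elem n (i + 1) (- 1)"
    unfolding sigma_elem_monomial[OF assms] s_elem_monomial t_elem_monomial
    by (subst monomial_mat_mult) (auto intro!: monomial_mat_cong)
  moreover have "s_elem n i (i + 1) = swaprows_mat n i (i + 1)"
    unfolding s_elem_def perm_matrix_def swaprows_mat_def
    by (rule eq_matI) (auto simp: Transposition.transpose_def)
  moreover have "det (swaprows_mat n i (i + 1) * t_elem n (i + 1) (- 1))
      = det (swaprows_mat n i (i + 1)) * det (t_elem n (i + 1) (- 1))"
    by (rule det_mult[of _ n]) (simp_all add: t_elem_def swaprows_mat_def)
  moreover have "i < n" "i + 1 < n" using assms by auto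
  ultimately show ?thesis
    using det_swaprows_mat[of i n "i + 1", where 'a = complex] det_t_elem[of "i + 1" n "- 1"] by simp
qed

lemma sigma_elem_GL: "i < n - 1 \<Longrightarrow> sigma_elem n i (i + 1) 1 \<in> carrier (GL n)"
  by (simp only: GL_iff_det det_sigma_elem) (simp add: sigma_elem_def)

lemma sigma_word_monomial:
  assumes "set w \<subseteq> {..<n - 1}"
  shows "\<exists>e. word_prod (GL n) (\<lambda>i. sigma_elem n i (i + 1) 1) w = monomial_mat n (word_perm w) e
    \<and> (\<forall>c<n. e c = 1 \<or> e c = - 1)"
  using assms
proof (induction w)
  case Nil
  have "word_prod (GL n) (\<lambda>i. sigma_elem n i (i + 1) 1) [] = monomial_mat n (word_perm []) (\<lambda>_. 1)"
    by (simp only: word_prod_Nil word_perm_Nil one_GL one_monomial_mat)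
  then show ?case by blast
next
  case (Cons i w)
  then obtain e where e: "word_prod (GL n) (\<lambda>i. sigma_elem n i (i + 1) 1) w = monomial_mat n (word_perm w) e"
    "\<forall>c<n. e c = 1 \<or> e c = - 1" by auto
  have "i < n - 1" and w: "word_perm w permutes {0..<n}" using Cons.prems word_perm_permutes by auto
  let ?d = "\<lambda>c. if c = Suc i then - 1 else 1 :: complex"
  have "word_prod (GL n) (\<lambda>i. sigma_elem n i (i + 1) 1) (i # w)
      = monomial_mat n (word_perm (i # w)) (\<lambda>c. ?d (word_perm w c) * e c)"
    unfolding word_prod_Cons e(1) sigma_elem_monomial[OF \<open>i < n - 1\<close>] mult_GL word_perm_Cons
    using permutes_less[OF w] by (rule monomial_mat_mult)
  moreover have "\<forall>c<n. ?d (word_perm w c) * e c = 1 \<or> ?d (word_perm w c) * e c = - 1"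
    using e(2) by auto
  ultimately show ?case by blast
qed

lemma det_sigma_word:
  assumes "set w \<subseteq> {..<n - 1}"
  shows "word_prod (GL n) (\<lambda>i. sigma_elem n i (i + 1) 1) w \<in> carrier (GL n)
    \<and> det (word_prod (GL n) (\<lambda>i. sigma_elem n i (i + 1) 1) w) = 1"
proof -
  interpret group "GL n" by (rule group_GL)
  show ?thesis
    using assms
    by (induction w) (auto simp: det_one_GL det_mult_GL sigma_elem_GL[simplified] det_sigma_elem[simplified])
qed

lemma conj_s_elem_monomial:
  assumes "i < n - 1"
  shows "conj_action n (s_elem n i (i + 1)) (monomial_mat n id d)
    = monomial_mat n id (\<lambda>c. d (adjacent_swap i c))"
proof -
  interpret group "GL n" by (rule group_GL)
  let ?s = "monomial_mat n (adjacent_swap i) (\<lambda>_. 1)"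
  have s: "?s \<in> carrier (GL n)"
    using assms by (intro monomial_mat_GL adjacent_swap_permutes) auto
  have "?s \<otimes>\<^bsub>GL n\<^esub> ?s = \<one>\<^bsub>GL n\<^esub>"
    unfolding mult_GL one_GL one_monomial_mat using adjacent_swap_less[OF assms]
    by (subst monomial_mat_mult) (auto intro!: monomial_mat_cong)
  then have "inv\<^bsub>GL n\<^esub> ?s = ?s" using s by (intro inv_equality)
  then have "conj_action n (s_elem n i (i + 1)) (monomial_mat n id d)
      = ?s * monomial_mat n id d * ?s"
    by (simp only: conj_action_def s_elem_monomial mult_GL)
  also have "\<dots> = monomial_mat n id (\<lambda>c. d (adjacent_swap i c))"
    using adjacent_swap_less[OF assms] 
    by (simp add: monomial_mat_mult) (auto intro!: monomial_mat_cong)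
  finally show ?thesis .
qed

text \<open>
  Conjugation by \<open>s\<^bsub>i,i+1\<^esub>\<close> swaps two diagonal entries, so it is an involution of \<open>T(m,p,n)\<close>. The matrix
  \<open>\<sigma>\<^sub>i\<close> differs from \<open>s\<^bsub>i,i+1\<^esub>\<close> by a diagonal factor, which commutes with \<open>t\<close>; so both conjugate
  \<open>t\<close> in the same way.
\<close>

lemma conj_s_elem_T_group:
  assumes "m > 0" "i < n - 1" "t \<in> T_group m p n"
  shows "conj_action n (s_elem n i (i + 1)) t \<in> T_group m p n"
    and "conj_action n (s_elem n i (i + 1)) (conj_action n (s_elem n i (i + 1)) t) = t"
    and "sigma_elem n i (i + 1) 1 \<otimes>\<^bsub>GL n\<^esub> t \<otimes>\<^bsub>GL n\<^esub> inv\<^bsub>GL n\<^esub> sigma_elem n i (i + 1) 1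
      = conj_action n (s_elem n i (i + 1)) t"
proof -
  interpret group "GL n" by (rule group_GL)
  let ?s = "s_elem n i (i + 1)" and ?\<sigma> = "sigma_elem n i (i + 1) 1"
  obtain d where d: "t = monomial_mat n id d" "\<forall>c<n. d c ^ m = 1"
    and D: "det t \<in> roots_of_unity (m div p)"
    using assms(3) unfolding T_group_iff[OF assms(1)] by blast
  have tc: "t \<in> carrier (GL n)" using assms(3) subgroup.subset[OF subgroup_T_group] by blast
  have sc: "?s \<in> carrier (GL n)"
    unfolding s_elem_monomial using assms by (intro monomial_mat_GL adjacent_swap_permutes) auto
  have ct: "conj_action n ?s t = monomial_mat n id (\<lambda>c. d (adjacent_swap i c))"
    unfolding d(1) by (rule conj_s_elem_monomial[OF assms(2)])
  have "det (conj_action n ?s t) = det (?s \<otimes>\<^bsub>GL n\<^esub> inv\<^bsub>GL n\<^esub> ?s) * det t"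
    unfolding conj_action_def using sc tc by (simp only: det_mult_GL m_closed inv_closed) simp
  then have "det (conj_action n ?s t) = det t" using sc by (simp add: det_one_GL)
  then show T: "conj_action n ?s t \<in> T_group m p n"
    unfolding T_group_iff[OF assms(1)] using D d(2) adjacent_swap_less[OF assms(2)] ct by auto
  show "conj_action n ?s (conj_action n ?s t) = t"
    unfolding ct conj_s_elem_monomial[OF assms(2)] d(1) by simp
  have "?\<sigma> \<otimes>\<^bsub>GL n\<^esub> t = conj_action n ?s t \<otimes>\<^bsub>GL n\<^esub> ?\<sigma>"
    unfolding ct unfolding sigma_elem_monomial[OF assms(2)] mult_GL d(1)
    by (simp add: monomial_mat_mult adjacent_swap_less[OF assms(2)])
      (auto intro!: monomial_mat_cong)
  moreover have "conj_action n ?s t \<in> carrier (GL n)" using sc tc by (simp add: conj_action_def)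
  ultimately show "?\<sigma> \<otimes>\<^bsub>GL n\<^esub> t \<otimes>\<^bsub>GL n\<^esub> inv\<^bsub>GL n\<^esub> ?\<sigma> = conj_action n ?s t"
    using sigma_elem_GL[OF assms(2)] by (simp add: m_assoc)
qed

text \<open>
  Evenness of \<open>m\<close> enters here: \<open>\<sigma>\<^sub>i\<^sup>2\<close> has two diagonal entries \<open>-1\<close>, which must be \<open>m\<close>-th roots of unity
  for the right-hand side of relation (i) to be an element of \<open>T(m,p,n)\<close>.
\<close>

lemma t_elem_pair_T_group:
  assumes "m > 0" "even m" "i < n - 1"
  shows "t_elem n i (- 1) \<otimes>\<^bsub>GL n\<^esub> t_elem n (i + 1) (- 1) \<in> T_group m p n"
    and "sigma_elem n i (i + 1) 1 \<otimes>\<^bsub>GL n\<^esub> sigma_elem n i (i + 1) 1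
      = t_elem n i (- 1) \<otimes>\<^bsub>GL n\<^esub> t_elem n (i + 1) (- 1)"
proof -
  let ?d = "\<lambda>c. if c = i \<or> c = Suc i then - 1 else 1 :: complex"
  have eq: "t_elem n i (- 1) \<otimes>\<^bsub>GL n\<^esub> t_elem n (i + 1) (- 1) = monomial_mat n id ?d"
    unfolding mult_GL t_elem_monomial
    by (subst monomial_mat_mult) (auto intro!: monomial_mat_cong)
  have "det (t_elem n i (- 1) * t_elem n (i + 1) (- 1))
      = det (t_elem n i (- 1)) * det (t_elem n (i + 1) (- 1))"
    by (rule det_mult[of _ n]) (simp_all add: t_elem_def)
  then have "det (t_elem n i (- 1) \<otimes>\<^bsub>GL n\<^esub> t_elem n (i + 1) (- 1)) = 1"
    using assms(3) det_t_elem[of i n "- 1"] det_t_elem[of "i + 1" n "- 1"] by (simp add: mult_GL)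
  then show "t_elem n i (- 1) \<otimes>\<^bsub>GL n\<^esub> t_elem n (i + 1) (- 1) \<in> T_group m p n"
    unfolding T_group_iff[OF assms(1)] using assms(2) eq by (auto simp: roots_of_unity_def)
  show "sigma_elem n i (i + 1) 1 \<otimes>\<^bsub>GL n\<^esub> sigma_elem n i (i + 1) 1
      = t_elem n i (- 1) \<otimes>\<^bsub>GL n\<^esub> t_elem n (i + 1) (- 1)"
    unfolding eq unfolding mult_GL sigma_elem_monomial[OF assms(3)]
    by (simp add: monomial_mat_mult adjacent_swap_less[OF assms(3)])
      (rule monomial_mat_cong, auto simp: adjacent_swap_def Transposition.transpose_def)
qed

lemma sigma_elem_far:
  assumes "i < n - 1" "j < n - 1" "j + 1 < i"
  shows "sigma_elem n i (i + 1) 1 \<otimes>\<^bsub>GL n\<^esub> sigma_elem n j (j + 1) 1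
    = sigma_elem n j (j + 1) 1 \<otimes>\<^bsub>GL n\<^esub> sigma_elem n i (i + 1) 1"
  unfolding mult_GL sigma_elem_monomial[OF assms(1)] sigma_elem_monomial[OF assms(2)]
  using assms(3)
  by (simp add: monomial_mat_mult adjacent_swap_less[OF assms(1)] adjacent_swap_less[OF assms(2)])
    (rule monomial_mat_cong, auto simp: adjacent_swap_def Transposition.transpose_def)

lemma sigma_elem_braid:
  assumes "i + 1 < n - 1"
  shows "sigma_elem n i (i + 1) 1 \<otimes>\<^bsub>GL n\<^esub> sigma_elem n (i + 1) (i + 1 + 1) 1 \<otimes>\<^bsub>GL n\<^esub> sigma_elem n i (i + 1) 1
    = sigma_elem n (i + 1) (i + 1 + 1) 1 \<otimes>\<^bsub>GL n\<^esub> sigma_elem n i (i + 1) 1 \<otimes>\<^bsub>GL n\<^esub> sigma_elem n (i + 1) (i + 1 + 1) 1"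
proof -
  have i: "i < n - 1" and i': "Suc i < n - 1" using assms by auto
  show ?thesis
    unfolding mult_GL sigma_elem_monomial[OF i] sigma_elem_monomial[OF assms]
    by (simp add: monomial_mat_mult adjacent_swap_less[OF i] adjacent_swap_less[OF i'])
      (rule monomial_mat_cong, auto simp: adjacent_swap_def Transposition.transpose_def)
qed

section \<open>The presented group\<close>

lemma group_T_monoid: "group (T_monoid m p n)"
  by (rule subgroup.subgroup_is_group[OF subgroup_T_group group_GL])

lemma free_sigma_closed: "i < n - 1 \<Longrightarrow> free_sigma m p n i \<in> carrier (free_braid_torus m p n)"
  unfolding free_sigma_def free_braid_torus_def
  by (rule hom_in_carrier[OF free_product_inl_hom[OF group_free_group group_T_monoid]])
    (simp add: free_gen_closed)

lemma free_torus_hom: "free_torus m p n \<in> hom (T_monoid m p n) (free_braid_torus m p n)"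
  unfolding free_torus_def[abs_def] free_braid_torus_def
  by (rule free_product_inr_hom[OF group_free_group group_T_monoid])

lemma free_torus_closed: "t \<in> T_group m p n \<Longrightarrow> free_torus m p n t \<in> carrier (free_braid_torus m p n)"
  using hom_in_carrier[OF free_torus_hom] by simp

lemma free_braid_torus_universal:
  assumes "group K" and s: "\<And>i. i < n - 1 \<Longrightarrow> s i \<in> carrier K" and k: "k \<in> hom (T_monoid m p n) K"
  obtains h where "h \<in> hom (free_braid_torus m p n) K"
    and "\<And>i. i < n - 1 \<Longrightarrow> h (free_sigma m p n i) = s i"
    and "\<And>t. t \<in> T_group m p n \<Longrightarrow> h (free_torus m p n t) = k t"
proof -
  let ?S = "{0..<n - 1}"
  have s': "s i \<in> carrier K" if "i \<in> ?S" for i using s that by simp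
  obtain g where g: "g \<in> hom (free_group ?S) K" "\<And>i. i \<in> ?S \<Longrightarrow> g (free_gen ?S i) = s i"
  proof (rule free_group_universal[where g = s and S = ?S, OF assms(1)])
    show "s i \<in> carrier K" if "i \<in> ?S" for i using that by (rule s')
  next
    fix g assume "g \<in> hom (free_group ?S) K" "\<And>i. i \<in> ?S \<Longrightarrow> g (free_gen ?S i) = s i"
    then show thesis by (rule that)
  qed
  obtain h where h: "h \<in> hom (free_product (free_group ?S) (T_monoid m p n)) K"
    "\<And>a. a \<in> carrier (free_group ?S) \<Longrightarrow> h (free_product_inl (free_group ?S) (T_monoid m p n) a) = g a"
    "\<And>b. b \<in> carrier (T_monoid m p n) \<Longrightarrow> h (free_product_inr (free_group ?S) (T_monoid m p n) b) = k b"
  proof (rule free_product_universal[OF group_free_group group_T_monoid assms(1) g(1) k])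
    fix h assume "h \<in> hom (free_product (free_group ?S) (T_monoid m p n)) K"
      "\<And>a. a \<in> carrier (free_group ?S) \<Longrightarrow> h (free_product_inl (free_group ?S) (T_monoid m p n) a) = g a"
      "\<And>b. b \<in> carrier (T_monoid m p n) \<Longrightarrow> h (free_product_inr (free_group ?S) (T_monoid m p n) b) = k b"
    then show thesis by (rule that)
  qed
  show thesis
  proof (rule that)
    show "h \<in> hom (free_braid_torus m p n) K" unfolding free_braid_torus_def by (rule h(1))
    show "h (free_sigma m p n i) = s i" if "i < n - 1" for i
    proof -
      have i: "i \<in> ?S" using that by simp
      show ?thesis unfolding free_sigma_def h(2)[OF free_gen_closed[OF i]] by (rule g(2)[OF i])
    qed
    show "h (free_torus m p n t) = k t" if "t \<in> T_group m p n" for t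
      unfolding free_torus_def by (rule h(3)) (simp add: that)
  qed
qed

lemma free_braid_torus_generated:
  "carrier (free_braid_torus m p n) = generate (free_braid_torus m p n)
    (free_sigma m p n ` {..<n - 1} \<union> free_torus m p n ` T_group m p n)"
    (is "_ = generate ?F ?L")
proof
  let ?B = "free_group {0..<n - 1}" and ?T = "T_monoid m p n"
  interpret F: group ?F by (rule group_free_braid_torus)
  interpret B: group ?B by (rule group_free_group)
  have hom: "free_product_inl ?B ?T \<in> hom ?B ?F"
    unfolding free_braid_torus_def by (rule free_product_inl_hom[OF group_free_group group_T_monoid])
  interpret inl: group_hom ?B ?F "free_product_inl ?B ?T" using hom by unfold_locales
  have L: "?L \<subseteq> carrier ?F" using free_sigma_closed free_torus_closed by auto
  then show "generate ?F ?L \<subseteq> carrier ?F" by (rule F.generate_incl)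
  have "free_product_inl ?B ?T ` carrier ?B
      = generate ?F (free_product_inl ?B ?T ` free_gen {0..<n - 1} ` {0..<n - 1})"
    by (subst inl.generate_img) (auto simp: free_gen_closed simp flip: free_group_generated)
  also have "\<dots> = generate ?F (free_sigma m p n ` {..<n - 1})"
    by (simp add: image_image free_sigma_def lessThan_atLeast0)
  also have "\<dots> \<subseteq> generate ?F ?L" by (rule F.mono_generate) simp
  finally have "free_product_inl ?B ?T ` carrier ?B \<union> free_product_inr ?B ?T ` carrier ?T \<subseteq> generate ?F ?L"
    by (auto simp: free_torus_def intro: generate.incl)
  then have "generate ?F (free_product_inl ?B ?T ` carrier ?B \<union> free_product_inr ?B ?T ` carrier ?T)
      \<subseteq> generate ?F ?L"
    by (rule F.generate_subgroup_incl[OF _ F.generate_is_subgroup[OF L]])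
  then show "carrier ?F \<subseteq> generate ?F ?L"
    using free_product_generated[OF group_free_group group_T_monoid]
    unfolding free_braid_torus_def by blast
qed

lemma mystic_rels_cases:
  assumes "(u, v) \<in> mystic_rels m p n"
  obtains
    (square) i where "i < n - 1"
      "u = free_sigma m p n i \<otimes>\<^bsub>free_braid_torus m p n\<^esub> free_sigma m p n i"
      "v = free_torus m p n (t_elem n i (- 1) \<otimes>\<^bsub>GL n\<^esub> t_elem n (i + 1) (- 1))"
  | (far) i j where "i < n - 1" "j < n - 1" "j + 1 < i"
      "u = free_sigma m p n i \<otimes>\<^bsub>free_braid_torus m p n\<^esub> free_sigma m p n j"
      "v = free_sigma m p n j \<otimes>\<^bsub>free_braid_torus m p n\<^esub> free_sigma m p n i"
  | (braid) i where "i + 1 < n - 1"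
      "u = free_sigma m p n i \<otimes>\<^bsub>free_braid_torus m p n\<^esub> free_sigma m p n (i + 1)
        \<otimes>\<^bsub>free_braid_torus m p n\<^esub> free_sigma m p n i"
      "v = free_sigma m p n (i + 1) \<otimes>\<^bsub>free_braid_torus m p n\<^esub> free_sigma m p n i
        \<otimes>\<^bsub>free_braid_torus m p n\<^esub> free_sigma m p n (i + 1)"
  | (conj) i t where "i < n - 1" "t \<in> T_group m p n"
      "u = free_sigma m p n i \<otimes>\<^bsub>free_braid_torus m p n\<^esub> free_torus m p n t
        \<otimes>\<^bsub>free_braid_torus m p n\<^esub> inv\<^bsub>free_braid_torus m p n\<^esub> free_sigma m p n i"
      "v = free_torus m p n (conj_action n (s_elem n i (i + 1)) t)"
  using assms unfolding mystic_rels_def Let_def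
  by (elim UnE CollectE exE conjE Pair_inject)
    (erule (2) that(1) | erule (4) that(2) | erule (2) that(3) | erule (3) that(4))+

text \<open>
  The relations (i) and (iii) involve torus letters, which denote elements of the free
  product only if the matrices in question lie in \<open>T(m,p,n)\<close>.
\<close>

lemma mystic_rels_closed:
  assumes "m > 0" "even m"
  shows "mystic_rels m p n \<subseteq> carrier (free_braid_torus m p n) \<times> carrier (free_braid_torus m p n)"
proof clarify
  interpret F: group "free_braid_torus m p n" by (rule group_free_braid_torus)
  fix u v assume "(u, v) \<in> mystic_rels m p n"
  then show "u \<in> carrier (free_braid_torus m p n) \<and> v \<in> carrier (free_braid_torus m p n)"
    by (cases rule: mystic_rels_cases)
      (use t_elem_pair_T_group(1)[OF assms] conj_s_elem_T_group(1)[OF assms(1)] in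
        \<open>simp_all add: free_sigma_closed free_torus_closed\<close>)
qed

lemma presented_group_universal:
  assumes "m > 0" "even m" "group K"
    and s: "\<And>i. i < n - 1 \<Longrightarrow> s i \<in> carrier K" and k: "k \<in> hom (T_monoid m p n) K"
    and square: "\<And>i. i < n - 1 \<Longrightarrow>
      s i \<otimes>\<^bsub>K\<^esub> s i = k (t_elem n i (- 1) \<otimes>\<^bsub>GL n\<^esub> t_elem n (i + 1) (- 1))"
    and far: "\<And>i j. \<lbrakk>i < n - 1; j < n - 1; j + 1 < i\<rbrakk> \<Longrightarrow> s i \<otimes>\<^bsub>K\<^esub> s j = s j \<otimes>\<^bsub>K\<^esub> s i"
    and braid: "\<And>i. i + 1 < n - 1 \<Longrightarrow>
      s i \<otimes>\<^bsub>K\<^esub> s (i + 1) \<otimes>\<^bsub>K\<^esub> s i = s (i + 1) \<otimes>\<^bsub>K\<^esub> s i \<otimes>\<^bsub>K\<^esub> s (i + 1)"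
    and conj: "\<And>i t. \<lbrakk>i < n - 1; t \<in> T_group m p n\<rbrakk> \<Longrightarrow>
      s i \<otimes>\<^bsub>K\<^esub> k t \<otimes>\<^bsub>K\<^esub> inv\<^bsub>K\<^esub> s i = k (conj_action n (s_elem n i (i + 1)) t)"
  obtains \<phi> where "\<phi> \<in> hom (presented_group m p n) K"
    and "\<And>i. i < n - 1 \<Longrightarrow> \<phi> (presented_sigma m p n i) = s i"
    and "\<And>t. t \<in> T_group m p n \<Longrightarrow> \<phi> (presented_torus m p n t) = k t"
proof -
  let ?F = "free_braid_torus m p n"
  obtain h where h: "h \<in> hom ?F K" "\<And>i. i < n - 1 \<Longrightarrow> h (free_sigma m p n i) = s i"
    "\<And>t. t \<in> T_group m p n \<Longrightarrow> h (free_torus m p n t) = k t"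
  proof (rule free_braid_torus_universal[where s = s, OF assms(3) _ k])
    show "s i \<in> carrier K" if "i < n - 1" for i using that by (rule s)
  next
    fix h assume "h \<in> hom ?F K" "\<And>i. i < n - 1 \<Longrightarrow> h (free_sigma m p n i) = s i"
      "\<And>t. t \<in> T_group m p n \<Longrightarrow> h (free_torus m p n t) = k t"
    then show thesis by (rule that)
  qed
  interpret K: group K by fact
  interpret F: group ?F by (rule group_free_braid_torus)
  interpret h: group_hom ?F K h using h(1) by unfold_locales
  note rels = mystic_rels_closed[OF assms(1,2)]
  have rel: "h u = h v" if "(u, v) \<in> mystic_rels m p n" for u v
    using that
  proof (cases rule: mystic_rels_cases)
    case (square i)
    then show ?thesis
      using assms(6) h(2,3) t_elem_pair_T_group(1)[OF assms(1,2)] by (simp add: free_sigma_closed)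
  next
    case (far i j)
    then show ?thesis using assms(7) h(2) by (simp add: free_sigma_closed)
  next
    case (braid i)
    then show ?thesis using assms(8)[of i] h(2) by (simp add: free_sigma_closed)
  next
    case (conj i t)
    then show ?thesis
      using assms(9)[of i t] h(2,3) conj_s_elem_T_group(1)[OF assms(1)]
      by (simp add: free_sigma_closed free_torus_closed)
  qed
  obtain \<phi> where "\<phi> \<in> hom (presented_group m p n) K"
    "\<And>x. x \<in> carrier ?F \<Longrightarrow> \<phi> (quotient_class ?F (mystic_rels m p n) x) = h x"
  proof (rule quotient_by_rels_universal[OF group_free_braid_torus assms(3) rels h(1)])
    show "h u = h v" if "(u, v) \<in> mystic_rels m p n" for u v using that by (rule rel)
  next
    fix \<phi> assume "\<phi> \<in> hom (quotient_by_rels ?F (mystic_rels m p n)) K"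
      "\<And>x. x \<in> carrier ?F \<Longrightarrow> \<phi> (quotient_class ?F (mystic_rels m p n) x) = h x"
    then show thesis unfolding presented_group_def[symmetric] by (rule that)
  qed
  then show thesis
    using that h(2,3) by (simp add: presented_sigma_def presented_torus_def free_sigma_closed free_torus_closed)
qed

context
  fixes m p n :: nat
  assumes m: "m > 0" "even m"
begin

lemma presented_class_hom:
  "quotient_class (free_braid_torus m p n) (mystic_rels m p n)
    \<in> hom (free_braid_torus m p n) (presented_group m p n)"
  unfolding presented_group_def
  by (rule quotient_class_hom[OF group_free_braid_torus mystic_rels_closed[OF m]])

lemma group_presented_group: "group (presented_group m p n)"
  unfolding presented_group_def
  by (rule group_quotient_by_rels[OF group_free_braid_torus mystic_rels_closed[OF m]])

lemma group_hom_presented_class: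
  "group_hom (free_braid_torus m p n) (presented_group m p n)
    (quotient_class (free_braid_torus m p n) (mystic_rels m p n))"
  using group_free_braid_torus group_presented_group presented_class_hom
  by (simp add: group_hom_def group_hom_axioms_def)

lemma presented_sigma_closed: "i < n - 1 \<Longrightarrow> presented_sigma m p n i \<in> carrier (presented_group m p n)"
  unfolding presented_sigma_def by (intro hom_in_carrier[OF presented_class_hom] free_sigma_closed)

lemma presented_torus_hom: "presented_torus m p n \<in> hom (T_monoid m p n) (presented_group m p n)"
  using hom_compose[OF free_torus_hom presented_class_hom]
  by (simp add: presented_torus_def[abs_def] comp_def)

lemma presented_group_generated:
  "carrier (presented_group m p n) = generate (presented_group m p n)
    (presented_sigma m p n ` {..<n - 1} \<union> presented_torus m p n ` T_group m p n)"
proof -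
  let ?F = "free_braid_torus m p n" and ?q = "quotient_class (free_braid_torus m p n) (mystic_rels m p n)"
  let ?L = "free_sigma m p n ` {..<n - 1} \<union> free_torus m p n ` T_group m p n"
  interpret q: group_hom ?F "presented_group m p n" ?q by (rule group_hom_presented_class)
  have L: "?L \<subseteq> carrier ?F" using free_sigma_closed free_torus_closed by auto
  have gens: "?q ` ?L = presented_sigma m p n ` {..<n - 1} \<union> presented_torus m p n ` T_group m p n"
    by (simp add: image_Un image_image presented_sigma_def presented_torus_def)
  have "carrier (presented_group m p n) = ?q ` carrier ?F"
    unfolding presented_group_def by (rule carrier_quotient_by_rels)
  also have "\<dots> = ?q ` generate ?F ?L" by (rule arg_cong[OF free_braid_torus_generated])
  also have "\<dots> = generate (presented_group m p n) (?q ` ?L)" by (rule q.generate_img[OF L, symmetric])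
  finally show ?thesis unfolding gens .
qed

lemma presented_relations:
  shows "i < n - 1 \<Longrightarrow> presented_sigma m p n i \<otimes>\<^bsub>presented_group m p n\<^esub> presented_sigma m p n i
      = presented_torus m p n (t_elem n i (- 1) \<otimes>\<^bsub>GL n\<^esub> t_elem n (i + 1) (- 1))" (is "_ \<Longrightarrow> ?square")
    and "\<lbrakk>i < n - 1; j < n - 1; j + 1 < i\<rbrakk> \<Longrightarrow>
      presented_sigma m p n i \<otimes>\<^bsub>presented_group m p n\<^esub> presented_sigma m p n j
      = presented_sigma m p n j \<otimes>\<^bsub>presented_group m p n\<^esub> presented_sigma m p n i" (is "\<lbrakk>_; _; _\<rbrakk> \<Longrightarrow> ?far")
    and "i + 1 < n - 1 \<Longrightarrow>
      presented_sigma m p n i \<otimes>\<^bsub>presented_group m p n\<^esub> presented_sigma m p n (i + 1)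
        \<otimes>\<^bsub>presented_group m p n\<^esub> presented_sigma m p n i
      = presented_sigma m p n (i + 1) \<otimes>\<^bsub>presented_group m p n\<^esub> presented_sigma m p n i
        \<otimes>\<^bsub>presented_group m p n\<^esub> presented_sigma m p n (i + 1)" (is "_ \<Longrightarrow> ?braid")
    and "\<lbrakk>i < n - 1; t \<in> T_group m p n\<rbrakk> \<Longrightarrow>
      presented_sigma m p n i \<otimes>\<^bsub>presented_group m p n\<^esub> presented_torus m p n t
        \<otimes>\<^bsub>presented_group m p n\<^esub> inv\<^bsub>presented_group m p n\<^esub> presented_sigma m p n i
      = presented_torus m p n (conj_action n (s_elem n i (i + 1)) t)" (is "\<lbrakk>_; _\<rbrakk> \<Longrightarrow> ?conj")
proof -
  interpret q: group_hom "free_braid_torus m p n" "presented_group m p n"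
    "quotient_class (free_braid_torus m p n) (mystic_rels m p n)"
    by (rule group_hom_presented_class)
  have rel: "quotient_class (free_braid_torus m p n) (mystic_rels m p n) u
      = quotient_class (free_braid_torus m p n) (mystic_rels m p n) v"
    if "(u, v) \<in> mystic_rels m p n" for u v
    using group_free_braid_torus mystic_rels_closed[OF m] that by (rule quotient_class_eq)
  let ?\<sigma> = "free_sigma m p n" and ?\<tau> = "free_torus m p n" and ?F = "free_braid_torus m p n"
  note defs = presented_sigma_def presented_torus_def
  show ?square if i: "i < n - 1"
  proof -
    have "(?\<sigma> i \<otimes>\<^bsub>?F\<^esub> ?\<sigma> i, ?\<tau> (t_elem n i (- 1) \<otimes>\<^bsub>GL n\<^esub> t_elem n (i + 1) (- 1))) \<in> mystic_rels m p n"
      using i unfolding mystic_rels_def Let_def by blast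
    from rel[OF this] show ?thesis using i by (simp add: defs free_sigma_closed)
  qed
  show ?far if i: "i < n - 1" "j < n - 1" "j + 1 < i"
  proof -
    have "(?\<sigma> i \<otimes>\<^bsub>?F\<^esub> ?\<sigma> j, ?\<sigma> j \<otimes>\<^bsub>?F\<^esub> ?\<sigma> i) \<in> mystic_rels m p n"
      using i unfolding mystic_rels_def Let_def by blast
    from rel[OF this] show ?thesis using i by (simp add: defs free_sigma_closed)
  qed
  show ?braid if i: "i + 1 < n - 1"
  proof -
    have "(?\<sigma> i \<otimes>\<^bsub>?F\<^esub> ?\<sigma> (i + 1) \<otimes>\<^bsub>?F\<^esub> ?\<sigma> i, ?\<sigma> (i + 1) \<otimes>\<^bsub>?F\<^esub> ?\<sigma> i \<otimes>\<^bsub>?F\<^esub> ?\<sigma> (i + 1)) \<in> mystic_rels m p n"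
      using i unfolding mystic_rels_def Let_def by blast
    from rel[OF this] show ?thesis using i by (simp add: defs free_sigma_closed)
  qed
  show ?conj if i: "i < n - 1" "t \<in> T_group m p n"
  proof -
    have "(?\<sigma> i \<otimes>\<^bsub>?F\<^esub> ?\<tau> t \<otimes>\<^bsub>?F\<^esub> inv\<^bsub>?F\<^esub> ?\<sigma> i, ?\<tau> (conj_action n (s_elem n i (i + 1)) t)) \<in> mystic_rels m p n"
      using i unfolding mystic_rels_def Let_def by blast
    from rel[OF this] show ?thesis using i by (simp add: defs free_sigma_closed free_torus_closed)
  qed
qed

text \<open>
  By relation (i) the squares lie in the image of the torus. By relation (iii), applied to the conjugate
  of \<open>x\<close> under the involution \<open>s\<^bsub>i,i+1\<^esub>\<close>, a torus element \<open>x\<close> can be moved past \<open>\<sigma>\<^sub>i\<close>.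
\<close>

lemma presented_group_coxeter:
  "coxeter_mod_subgroup (presented_group m p n) (presented_sigma m p n) (n - 1)
    (presented_torus m p n ` T_group m p n)"
proof -
  interpret P: group "presented_group m p n" by (rule group_presented_group)
  interpret T: group "T_monoid m p n" by (rule group_T_monoid)
  interpret \<tau>: group_hom "T_monoid m p n" "presented_group m p n" "presented_torus m p n"
    using presented_torus_hom by unfold_locales
  let ?P = "presented_group m p n" and ?a = "presented_sigma m p n" and ?\<tau> = "presented_torus m p n"
  have sub: "subgroup (?\<tau> ` T_group m p n) ?P"
    using \<tau>.img_is_subgroup by simp
  have past: "\<exists>t'\<in>?\<tau> ` T_group m p n. t \<otimes>\<^bsub>?P\<^esub> ?a i = ?a i \<otimes>\<^bsub>?P\<^esub> t'"
    if i: "i < n - 1" and t: "t \<in> ?\<tau> ` T_group m p n" for i t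
  proof -
    obtain x where x: "t = ?\<tau> x" "x \<in> T_group m p n" using t by blast
    let ?y = "conj_action n (s_elem n i (i + 1)) x"
    note y = conj_s_elem_T_group[OF m(1) i x(2)]
    have c: "?a i \<in> carrier ?P" "?\<tau> ?y \<in> carrier ?P" "t \<in> carrier ?P"
      using presented_sigma_closed[OF i] \<tau>.hom_closed y(1) x by auto
    have "?a i \<otimes>\<^bsub>?P\<^esub> ?\<tau> ?y \<otimes>\<^bsub>?P\<^esub> inv\<^bsub>?P\<^esub> ?a i = t"
      using presented_relations(4)[OF i y(1)] y(2) x(1) by simp
    then have "t \<otimes>\<^bsub>?P\<^esub> ?a i = ?a i \<otimes>\<^bsub>?P\<^esub> ?\<tau> ?y"
      using c by (metis P.inv_solve_right P.m_closed)
    then show ?thesis using y(1) by blast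
  qed
  interpret N: subgroup "?\<tau> ` T_group m p n" ?P by (rule sub)
  have square: "?a i \<otimes>\<^bsub>?P\<^esub> ?a i \<in> ?\<tau> ` T_group m p n" if i: "i < n - 1" for i
    unfolding presented_relations(1)[OF i] using t_elem_pair_T_group(1)[OF m i] by (rule imageI)
  show ?thesis
    by unfold_locales (fact presented_sigma_closed presented_relations(2,3) square past)+
qed

end

section \<open>The isomorphism\<close>

theorem theorem2p3:
  fixes n m p :: nat
  assumes "n \<ge> 1" and "m > 0" and "even m" and "p > 0" and "p dvd m"
  shows "\<exists>\<phi> \<in> iso (presented_group m p n) (mystic_monoid m p n).
           (\<forall>i < n - 1. \<phi> (presented_sigma m p n i) = sigma_elem n i (i + 1) 1) \<and>
           (\<forall>t \<in> T_group m p n. \<phi> (presented_torus m p n t) = t)"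
proof -
  note m = assms(2,3)
  let ?P = "presented_group m p n" and ?a = "presented_sigma m p n" and ?\<tau> = "presented_torus m p n"
  let ?\<sigma> = "\<lambda>i. sigma_elem n i (i + 1) 1" and ?C = "roots_of_unity (m div p)"
  interpret GL: group "GL n" by (rule group_GL)
  interpret P: coxeter_mod_subgroup ?P ?a "n - 1" "?\<tau> ` T_group m p n"
    by (rule presented_group_coxeter[OF m])
  interpret T: group "T_monoid m p n" by (rule group_T_monoid)
  interpret \<tau>: group_hom "T_monoid m p n" ?P ?\<tau>
    using presented_torus_hom[OF m] by unfold_locales
  have T: "t \<in> carrier (GL n)" if "t \<in> T_group m p n" for t
    using that subgroup.subset[OF subgroup_T_group] by blast
  then have incl: "(\<lambda>t. t) \<in> hom (T_monoid m p n) (GL n)" by (auto simp: hom_def)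
  obtain \<phi> where \<phi>: "\<phi> \<in> hom ?P (GL n)"
    "\<And>i. i < n - 1 \<Longrightarrow> \<phi> (?a i) = ?\<sigma> i" "\<And>t. t \<in> T_group m p n \<Longrightarrow> \<phi> (?\<tau> t) = t"
  proof (rule presented_group_universal[where s = ?\<sigma> and k = "\<lambda>t. t", OF m group_GL _ incl])
    show "?\<sigma> i \<in> carrier (GL n)" if "i < n - 1" for i using that by (rule sigma_elem_GL)
    show "?\<sigma> i \<otimes>\<^bsub>GL n\<^esub> ?\<sigma> i = t_elem n i (- 1) \<otimes>\<^bsub>GL n\<^esub> t_elem n (i + 1) (- 1)"
      if "i < n - 1" for i using that by (rule t_elem_pair_T_group(2)[OF m])
    show "?\<sigma> i \<otimes>\<^bsub>GL n\<^esub> ?\<sigma> j = ?\<sigma> j \<otimes>\<^bsub>GL n\<^esub> ?\<sigma> i"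
      if "i < n - 1" "j < n - 1" "j + 1 < i" for i j using that by (rule sigma_elem_far)
    show "?\<sigma> i \<otimes>\<^bsub>GL n\<^esub> ?\<sigma> (i + 1) \<otimes>\<^bsub>GL n\<^esub> ?\<sigma> i = ?\<sigma> (i + 1) \<otimes>\<^bsub>GL n\<^esub> ?\<sigma> i \<otimes>\<^bsub>GL n\<^esub> ?\<sigma> (i + 1)"
      if "i + 1 < n - 1" for i using that by (rule sigma_elem_braid)
    show "?\<sigma> i \<otimes>\<^bsub>GL n\<^esub> t \<otimes>\<^bsub>GL n\<^esub> inv\<^bsub>GL n\<^esub> ?\<sigma> i = conj_action n (s_elem n i (i + 1)) t"
      if "i < n - 1" "t \<in> T_group m p n" for i t using that by (rule conj_s_elem_T_group(3)[OF m(1)])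
  next
    fix \<phi> assume "\<phi> \<in> hom ?P (GL n)" "\<And>i. i < n - 1 \<Longrightarrow> \<phi> (?a i) = ?\<sigma> i"
      "\<And>t. t \<in> T_group m p n \<Longrightarrow> \<phi> (?\<tau> t) = t"
    then show thesis by (rule that)
  qed
  interpret \<phi>: group_hom ?P "GL n" \<phi> using \<phi>(1) by unfold_locales
  have factor: "\<exists>w t. set w \<subseteq> {..<n - 1} \<and> t \<in> T_group m p n \<and> g = word_prod ?P ?a w \<otimes>\<^bsub>?P\<^esub> ?\<tau> t"
    if g: "g \<in> carrier ?P" for g
    using g P.generated_factorization[of g] unfolding presented_group_generated[OF m] by blast
  have \<phi>_factor: "\<phi> (word_prod ?P ?a w \<otimes>\<^bsub>?P\<^esub> ?\<tau> t) = word_prod (GL n) ?\<sigma> w \<otimes>\<^bsub>GL n\<^esub> t"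
    if "set w \<subseteq> {..<n - 1}" "t \<in> T_group m p n" for w t
  proof -
    have "\<phi> (word_prod ?P ?a w) = word_prod (GL n) (\<lambda>i. \<phi> (?a i)) w"
      by (rule \<phi>.hom_word_prod) (use that(1) P.gen_closed in blast)
    also have "\<dots> = word_prod (GL n) ?\<sigma> w"
      by (rule word_prod_cong) (use that(1) \<phi>(2) in blast)
    finally show ?thesis
      using that \<phi>(3) P.word_closed[OF that(1)] P.N.subset by (simp add: image_subset_iff)
  qed
  have mono: "\<exists>e. word_prod (GL n) ?\<sigma> w \<otimes>\<^bsub>GL n\<^esub> monomial_mat n id d = monomial_mat n (word_perm w) (\<lambda>c. e c * d c)
      \<and> (\<forall>c<n. e c ^ m = 1)" if w: "set w \<subseteq> {..<n - 1}" for w d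
  proof -
    obtain e where e: "word_prod (GL n) ?\<sigma> w = monomial_mat n (word_perm w) e"
      "\<forall>c<n. e c = 1 \<or> e c = - 1" using sigma_word_monomial[OF w] by blast
    have "\<forall>c<n. e c ^ m = 1" using e(2) m(2) by auto
    then show ?thesis using e(1) by (auto simp: mult_GL monomial_mat_mult)
  qed
  have "\<phi> ` carrier ?P = mystic_group m p n"
  proof (intro equalityI subsetI)
    fix M assume "M \<in> \<phi> ` carrier ?P"
    then obtain g where g: "g \<in> carrier ?P" "M = \<phi> g" by blast
    obtain w t where w: "set w \<subseteq> {..<n - 1}" and t: "t \<in> T_group m p n"
      and gw: "g = word_prod ?P ?a w \<otimes>\<^bsub>?P\<^esub> ?\<tau> t"
      using factor[OF g(1)] by blast
    have M: "M = word_prod (GL n) ?\<sigma> w \<otimes>\<^bsub>GL n\<^esub> t"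
      unfolding g(2) gw by (rule \<phi>_factor[OF w t])
    obtain d where d: "t = monomial_mat n id d" "\<forall>c<n. d c ^ m = 1" and D: "det t \<in> ?C"
      using t unfolding T_group_iff[OF m(1)] by blast
    obtain e where e: "M = monomial_mat n (word_perm w) (\<lambda>c. e c * d c)" "\<forall>c<n. e c ^ m = 1"
      using mono[OF w, of d] unfolding M d(1) by blast
    define f where "f = (\<lambda>c. e c * d c)"
    have "M = monomial_mat n (word_perm w) f" "\<forall>c<n. f c ^ m = 1"
      using e d(2) by (simp_all add: f_def power_mult_distrib)
    moreover have "det M = det t"
      using det_sigma_word[OF w] T[OF t] by (simp only: M det_mult_GL) simp
    ultimately show "M \<in> mystic_group m p n"
      unfolding mystic_group_iff[OF m(1)] using word_perm_permutes[OF w] D by metis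
  next
    fix M assume "M \<in> mystic_group m p n"
    then obtain \<pi> d where \<pi>: "\<pi> permutes {0..<n}" and d: "\<forall>c<n. d c ^ m = 1"
      and M: "M = monomial_mat n \<pi> d" and D: "det M \<in> ?C"
      unfolding mystic_group_iff[OF m(1)] by blast
    obtain w where w: "set w \<subseteq> {..<n - 1}" "word_perm w = \<pi>"
      using permutation_eq_word_perm[OF \<pi>] by blast
    obtain e where e: "word_prod (GL n) ?\<sigma> w = monomial_mat n \<pi> e" "\<forall>c<n. e c = 1 \<or> e c = - 1"
      using sigma_word_monomial[OF w(1)] unfolding w(2) by blast
    \<comment> \<open>As \<open>e(c) = \<plusminus>1\<close> is its own inverse, this is the diagonal matrix of the quotients \<open>d(c) / e(c)\<close>.\<close>
    define t where "t = monomial_mat n id (\<lambda>c. e c * d c)"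
    have e2: "e c * (e c * d c) = d c" if "c < n" for c
      using e(2) that by auto
    have Mt: "M = word_prod (GL n) ?\<sigma> w \<otimes>\<^bsub>GL n\<^esub> t"
      unfolding e(1) t_def mult_GL M using e2 by (simp add: monomial_mat_mult) (auto intro: monomial_mat_cong)
    have em: "\<forall>c<n. (e c * d c) ^ m = 1"
      using e(2) d m(2) by (auto simp: power_mult_distrib)
    have "t \<in> T_group m 1 n" unfolding T_group_1_iff[OF m(1)] t_def using em by blast
    then have "t \<in> carrier (GL n)" by (simp add: T_group_def diag_matrices_def)
    then have "det M = det t"
      using det_sigma_word[OF w(1)] by (simp only: Mt det_mult_GL) simp
    then have "t \<in> T_group m p n"
      using D em unfolding T_group_iff[OF m(1)] t_def by auto
    then have "M = \<phi> (word_prod ?P ?a w \<otimes>\<^bsub>?P\<^esub> ?\<tau> t)" "word_prod ?P ?a w \<otimes>\<^bsub>?P\<^esub> ?\<tau> t \<in> carrier ?P"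
      using Mt \<phi>_factor[OF w(1)] P.word_closed[OF w(1)] \<tau>.hom_closed by auto
    then show "M \<in> \<phi> ` carrier ?P" by blast
  qed
  moreover have "inj_on \<phi> (carrier ?P)"
    unfolding \<phi>.inj_on_one_iff
  proof (intro allI impI)
    fix g assume gc: "g \<in> carrier ?P" and g1: "\<phi> g = \<one>\<^bsub>GL n\<^esub>"
    obtain w t where w: "set w \<subseteq> {..<n - 1}" and t: "t \<in> T_group m p n"
      and g: "g = word_prod ?P ?a w \<otimes>\<^bsub>?P\<^esub> ?\<tau> t"
      using factor[OF gc] by blast
    obtain d where d: "t = monomial_mat n id d" "\<forall>c<n. d c ^ m = 1"
      using t unfolding T_group_iff[OF m(1)] by blast
    obtain e where e: "\<phi> g = monomial_mat n (word_perm w) (\<lambda>c. e c * d c)" "\<forall>c<n. e c ^ m = 1"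
      using mono[OF w, of d] \<phi>_factor[OF w t] unfolding g d(1) by auto
    note pw = word_perm_permutes[OF w]
    have "word_perm w c = id c" if c: "c < n" for c
    proof (rule monomial_mat_perm_eq[OF _ c])
      show "monomial_mat n (word_perm w) (\<lambda>c. e c * d c) = monomial_mat n id (\<lambda>_. 1)"
        using e(1) g1 by (simp add: one_GL one_monomial_mat)
      show "word_perm w c < n" using permutes_less[OF pw c] .
      show "e c * d c \<noteq> 0" using root_nonzero[OF _ m(1)] d(2) e(2) c by auto
    qed
    moreover have "word_perm w c = id c" if "\<not> c < n" for c
      using permutes_not_in[OF pw, of c] that by simp
    ultimately have "word_perm w = id" by blast
    then have "word_prod ?P ?a w \<in> ?\<tau> ` T_group m p n"
      using P.word_perm_id_imp_mem[OF w] by simp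
    then have "g \<in> ?\<tau> ` T_group m p n" unfolding g using t by auto
    then obtain u where u: "u \<in> T_group m p n" "g = ?\<tau> u" by blast
    then have "u = \<one>\<^bsub>T_monoid m p n\<^esub>" using \<phi>(3)[OF u(1)] g1 by simp
    then show "g = \<one>\<^bsub>?P\<^esub>" using u(2) \<tau>.hom_one by simp
  qed
  moreover have "\<phi> \<in> hom ?P (mystic_monoid m p n)"
    using \<open>\<phi> ` carrier ?P = mystic_group m p n\<close> \<phi>(1) by (auto simp: hom_def)
  ultimately have "\<phi> \<in> iso ?P (mystic_monoid m p n)" by (simp add: iso_def bij_betw_def)
  then show ?thesis using \<phi>(2,3) by blast
qed

end
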